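(* Let $\Gamma$ be a group and $\epsilon>\eta(\Gamma)$. Then $$\sup_\Lambda\frac{\beta^{(2)}_1(\Lambda)}{\mathrm{rk}(\Lambda)^{\epsilon}}<\infty,$$ where the supremum runs over all finitely generated subgroups $\Lambda$ of $\Gamma$.
   Context: $\beta^{(2)}_1(\Lambda)$ is the first $L^2$-Betti number of $\Lambda$ and $\mathrm{rk}(\Lambda)$ the minimal number of generators of $\Lambda$. For finite symmetric $S\subseteq\Gamma$: $\mathrm{Cay}(\Gamma,S)$ has vertex set $\Gamma$ and an edge between $g$ and $gs$ for each $s\in S$; $\partial_SF$ is the set of edges from a finite $F$ to its complement; $h(\Gamma,S)=\inf_F|\partial_SF|/|F|$ over non-empty finite $F$; $e(\Gamma,S)=1-h(\Gamma,S)/|S|$. $\eta(\Gamma)=-\liminf_S\frac{\ln e(\Gamma,S)}{\ln|S|}$, the liminf over the directed set of finite symmetric subsets ordered by inclusion ($\liminf_Sf(S)=\sup_S\inf_{S'\supseteq S}f(S')$), with $\eta(\Gamma)=-\infty$ if $\Gamma$ is finite. *)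

theory Defs
  imports "HOL-Analysis.Analysis" "HOL-Algebra.Generated_Groups"
begin

definition l2 :: "'i set \<Rightarrow> ('i \<Rightarrow> complex) set" where
  "l2 I = {x. (\<forall>i. i \<notin> I \<longrightarrow> x i = 0) \<and> (\<lambda>i. (cmod (x i))\<^sup>2) summable_on I}"

definition l2_inner :: "'i set \<Rightarrow> ('i \<Rightarrow> complex) \<Rightarrow> ('i \<Rightarrow> complex) \<Rightarrow> complex" where
  "l2_inner I x y = (\<Sum>\<^sub>\<infinity>i\<in>I. x i * cnj (y i))"

definition l2_norm :: "'i set \<Rightarrow> ('i \<Rightarrow> complex) \<Rightarrow> real" where
  "l2_norm I x = sqrt (\<Sum>\<^sub>\<infinity>i\<in>I. (cmod (x i))\<^sup>2)"

definition l2_closure :: "'i set \<Rightarrow> ('i \<Rightarrow> complex) set \<Rightarrow> ('i \<Rightarrow> complex) set" where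
  "l2_closure I A = {x \<in> l2 I. \<forall>e>0. \<exists>a\<in>A. l2_norm I (x - a) < e}"

definition l2_proj :: "'i set \<Rightarrow> ('i \<Rightarrow> complex) set \<Rightarrow> ('i \<Rightarrow> complex) \<Rightarrow> ('i \<Rightarrow> complex)" where
  "l2_proj I V x = (THE p. p \<in> V \<and> (\<forall>v\<in>V. l2_inner I (x - p) v = 0))"

text \<open>For a finitely generated subgroup H of G and a finite generating set S of H,
  1-cocycles c : H \<rightarrow> l2(H) (left regular representation, (g.f)(x) = f(g^-1 x)),
  c(gh) = c(g) + g.c(h), are embedded into l2(S \<times> H) = l2(H)^S via c \<mapsto> (c(s))_{s\<in>S}.
  The image is a closed subspace invariant under the right regular action of H;
  its von Neumann dimension is the trace of the orthogonal projection.\<close>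

definition cocycles_S :: "('g, 'b) monoid_scheme \<Rightarrow> 'g set \<Rightarrow> 'g set \<Rightarrow> ('g \<times> 'g \<Rightarrow> complex) set" where
  "cocycles_S G H S = {v. \<exists>c :: 'g \<Rightarrow> 'g \<Rightarrow> complex.
      (\<forall>g\<in>H. c g \<in> l2 H) \<and>
      (\<forall>g\<in>H. \<forall>h\<in>H. \<forall>x\<in>H. c (g \<otimes>\<^bsub>G\<^esub> h) x = c g x + c h (inv\<^bsub>G\<^esub> g \<otimes>\<^bsub>G\<^esub> x)) \<and>
      (\<forall>s x. v (s, x) = (if s \<in> S then c s x else 0))}"

definition coboundaries_S :: "('g, 'b) monoid_scheme \<Rightarrow> 'g set \<Rightarrow> 'g set \<Rightarrow> ('g \<times> 'g \<Rightarrow> complex) set" where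
  "coboundaries_S G H S = {v. \<exists>f \<in> l2 H.
      (\<forall>s x. v (s, x) = (if s \<in> S \<and> x \<in> H then f (inv\<^bsub>G\<^esub> s \<otimes>\<^bsub>G\<^esub> x) - f x else 0))}"

text \<open>von Neumann dimension (over the group von Neumann algebra of H) of a closed
  invariant subspace V of l2(H)^S: sum over s of <P delta_(s,1), delta_(s,1)>.\<close>
definition vN_dim_S :: "('g, 'b) monoid_scheme \<Rightarrow> 'g set \<Rightarrow> 'g set \<Rightarrow> ('g \<times> 'g \<Rightarrow> complex) set \<Rightarrow> real" where
  "vN_dim_S G H S V = (\<Sum>s\<in>S. Re (l2_proj (S \<times> H) V (\<lambda>i. if i = (s, \<one>\<^bsub>G\<^esub>) then 1 else 0) (s, \<one>\<^bsub>G\<^esub>)))"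

text \<open>beta_1 = dim of reduced first l2-cohomology Z^1 / closure(B^1) = dim Z^1 - dim closure(B^1).\<close>
definition L2_betti1_S :: "('g, 'b) monoid_scheme \<Rightarrow> 'g set \<Rightarrow> 'g set \<Rightarrow> real" where
  "L2_betti1_S G H S = vN_dim_S G H S (cocycles_S G H S)
      - vN_dim_S G H S (l2_closure (S \<times> H) (coboundaries_S G H S))"

definition generating_set :: "('g, 'b) monoid_scheme \<Rightarrow> 'g set \<Rightarrow> 'g set \<Rightarrow> bool" where
  "generating_set G H S \<longleftrightarrow> finite S \<and> S \<subseteq> carrier G \<and> generate G S = H"

definition fg_subgroup :: "('g, 'b) monoid_scheme \<Rightarrow> 'g set \<Rightarrow> bool" where
  "fg_subgroup G H \<longleftrightarrow> subgroup H G \<and> (\<exists>S. generating_set G H S)"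

text \<open>Independent of the chosen finite generating set (standard fact).\<close>
definition L2_betti1 :: "('g, 'b) monoid_scheme \<Rightarrow> 'g set \<Rightarrow> real" where
  "L2_betti1 G H = L2_betti1_S G H (SOME S. generating_set G H S)"

definition rank :: "('g, 'b) monoid_scheme \<Rightarrow> 'g set \<Rightarrow> nat" where
  "rank G H = (LEAST n. \<exists>S. generating_set G H S \<and> card S = n)"

definition sym_fin :: "('g, 'b) monoid_scheme \<Rightarrow> 'g set \<Rightarrow> bool" where
  "sym_fin G S \<longleftrightarrow> finite S \<and> S \<subseteq> carrier G \<and> (\<forall>s\<in>S. inv\<^bsub>G\<^esub> s \<in> S)"

definition cay_boundary :: "('g, 'b) monoid_scheme \<Rightarrow> 'g set \<Rightarrow> 'g set \<Rightarrow> nat" where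
  "cay_boundary G S F = card {(g, s). g \<in> F \<and> s \<in> S \<and> g \<otimes>\<^bsub>G\<^esub> s \<notin> F}"

definition cheeger :: "('g, 'b) monoid_scheme \<Rightarrow> 'g set \<Rightarrow> real" where
  "cheeger G S = Inf {real (cay_boundary G S F) / real (card F) | F.
      finite F \<and> F \<noteq> {} \<and> F \<subseteq> carrier G}"

definition cay_e :: "('g, 'b) monoid_scheme \<Rightarrow> 'g set \<Rightarrow> real" where
  "cay_e G S = 1 - cheeger G S / real (card S)"

definition eta :: "('g, 'b) monoid_scheme \<Rightarrow> ereal" where
  "eta G = (if finite (carrier G) then -\<infinity> else
     - (SUP S\<in>{S. sym_fin G S}. INF S'\<in>{S'. sym_fin G S' \<and> S \<subseteq> S'}.
          ereal (ln (cay_e G S') / ln (real (card S')))))"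

end

theory Submission
  imports Defs
begin

text \<open>
  Let \<open>T\<close> be a minimal generating set of \<open>\<Lambda>\<close>, let \<open>P\<close> be the orthogonal projection of \<open>\<ell>\<^sup>2(T \<times> \<Lambda>)\<close> onto
  the space of cocycles, and put \<open>f s = \<langle>P \<delta>\<^bsub>(s,1)\<^esub>, \<delta>\<^bsub>(s,1)\<^esub>\<rangle> \<in> [0, 1]\<close>. The von Neumann dimension of the
  cocycles is \<open>\<Sum>s\<in>T. f s\<close>; it bounds the first \<open>L\<^sup>2\<close>-Betti number and does not depend on \<open>T\<close>.

  A cocycle is the gradient of a function on \<open>\<Lambda>\<close>, so its restriction to the edges inside a finite
  set \<open>F\<close> ranges over a space of dimension at most \<open>|F|\<close>. Comparing trace and rank, and using right
  invariance of \<open>P\<close>, one gets \<open>(\<Sum>s\<in>T. f s * |{g \<in> F. g s \<in> F}|) \<le> |F|\<close>, also for finite \<open>F \<subseteq> \<Gamma>\<close>.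

  Since \<open>\<eta>(\<Gamma>) < \<epsilon>\<close>, there is a finite symmetric \<open>S\<close> with \<open>e(\<Gamma>, S') \<ge> |S'| powr -\<epsilon>\<close> for all
  \<open>S' \<supseteq> S\<close>. If \<open>f \<ge> t\<close> on \<open>A \<subseteq> T\<close>, then \<open>S' = S \<union> A \<union> A\<^sup>-\<^sup>1\<close> satisfies \<open>|S'| e(\<Gamma>, S') \<le> |S| + 2/t\<close>, whence
  \<open>|A| powr (1 - \<epsilon>) \<le> (|S| + 2)/t\<close>. This decay of the level sets of \<open>f\<close> gives
  \<open>(\<Sum>s\<in>T. f s) = O(|T| powr \<epsilon>)\<close>.
\<close>

section \<open>Square-summable functions\<close>

text \<open>Squared norms keep the Hilbert space arguments free of roots; \<open>l2_norm\<close>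
  enters only through \<open>l2_closure\<close>.\<close>

definition l2_sq :: "'i set \<Rightarrow> ('i \<Rightarrow> complex) \<Rightarrow> real" where
  "l2_sq I x = (\<Sum>\<^sub>\<infinity>i\<in>I. (cmod (x i))\<^sup>2)"

definition l2_unit :: "'i \<Rightarrow> 'i \<Rightarrow> complex" where
  "l2_unit k = (\<lambda>i. if i = k then 1 else 0)"

lemma l2_supp: "x \<in> l2 I \<Longrightarrow> i \<notin> I \<Longrightarrow> x i = 0"
  by (auto simp: l2_def)

lemma l2_summable: "x \<in> l2 I \<Longrightarrow> (\<lambda>i. (cmod (x i))\<^sup>2) summable_on I"
  by (auto simp: l2_def)

lemma l2I_dominated:
  assumes g: "g summable_on I" and le: "\<And>i. i \<in> I \<Longrightarrow> (cmod (x i))\<^sup>2 \<le> g i"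
    and supp: "\<And>i. i \<notin> I \<Longrightarrow> x i = 0"
  shows "x \<in> l2 I"
proof -
  have "(\<lambda>i. (cmod (x i))\<^sup>2) summable_on I"
    by (rule summable_on_comparison_test[OF g]) (use le in auto)
  with supp show ?thesis by (auto simp: l2_def)
qed

lemma l2_zero: "(\<lambda>_. 0) \<in> l2 I"
  by (auto simp: l2_def)

lemma l2_scale: "x \<in> l2 I \<Longrightarrow> (\<lambda>i. c * x i) \<in> l2 I"
  by (auto simp: l2_def norm_mult power_mult_distrib intro!: summable_on_cmult_right)

lemma cmod_add_sq_le: "(cmod (a + b))\<^sup>2 \<le> 2 * (cmod a)\<^sup>2 + 2 * (cmod b)\<^sup>2"
proof -
  have "(cmod (a + b))\<^sup>2 + (cmod (a - b))\<^sup>2 = 2 * (cmod a)\<^sup>2 + 2 * (cmod b)\<^sup>2"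
    unfolding cmod_power2 by (simp add: power2_eq_square algebra_simps)
  then show ?thesis using zero_le_power2[of "cmod (a - b)"] by linarith
qed

lemma l2_add:
  assumes "x \<in> l2 I" "y \<in> l2 I" shows "(\<lambda>i. x i + y i) \<in> l2 I"
proof (rule l2I_dominated)
  show "(\<lambda>i. 2 * (cmod (x i))\<^sup>2 + 2 * (cmod (y i))\<^sup>2) summable_on I"
    by (intro summable_on_add summable_on_cmult_right l2_summable assms)
qed (use assms cmod_add_sq_le in \<open>auto simp: l2_supp\<close>)

lemma l2_uminus: "x \<in> l2 I \<Longrightarrow> (\<lambda>i. - x i) \<in> l2 I"
  using l2_scale[of x I "-1"] by simp

lemma l2_diff:
  assumes "x \<in> l2 I" "y \<in> l2 I" shows "(\<lambda>i. x i - y i) \<in> l2 I"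
  using l2_add[OF assms(1) l2_uminus[OF assms(2)]] by simp

lemma l2_unit: "k \<in> I \<Longrightarrow> l2_unit k \<in> l2 I"
proof -
  assume k: "k \<in> I"
  have "(\<lambda>i. (cmod (l2_unit k i))\<^sup>2) summable_on I \<longleftrightarrow> (\<lambda>i. (cmod (l2_unit k i))\<^sup>2) summable_on {k}"
    by (rule summable_on_cong_neutral) (use k in \<open>auto simp: l2_unit_def\<close>)
  with k show ?thesis by (auto simp: l2_def l2_unit_def)
qed

lemma l2_inner_summable:
  assumes "x \<in> l2 I" "y \<in> l2 I" shows "(\<lambda>i. x i * cnj (y i)) summable_on I"
proof (rule Infinite_Sum.abs_summable_summable, rule Infinite_Sum.abs_summable_on_comparison_test')
  show "(\<lambda>i. (cmod (x i))\<^sup>2 + (cmod (y i))\<^sup>2) summable_on I"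
    by (intro summable_on_add l2_summable assms)
  fix i
  have "2 * (cmod (x i) * cmod (y i)) \<le> (cmod (x i))\<^sup>2 + (cmod (y i))\<^sup>2"
    using sum_squares_bound[of "cmod (x i)" "cmod (y i)"] by simp
  moreover have "0 \<le> cmod (x i) * cmod (y i)" by simp
  ultimately show "norm (x i * cnj (y i)) \<le> (cmod (x i))\<^sup>2 + (cmod (y i))\<^sup>2"
    unfolding norm_mult complex_mod_cnj by linarith
qed

lemma l2_inner_cnj: "l2_inner I y x = cnj (l2_inner I x y)"
  unfolding l2_inner_def infsum_cnj[symmetric] by (simp add: mult.commute)

lemma l2_inner_add_left:
  "x \<in> l2 I \<Longrightarrow> y \<in> l2 I \<Longrightarrow> z \<in> l2 I \<Longrightarrow>
    l2_inner I (\<lambda>i. x i + y i) z = l2_inner I x z + l2_inner I y z"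
  unfolding l2_inner_def by (subst infsum_add[symmetric]) (auto simp: l2_inner_summable algebra_simps)

lemma l2_inner_scale_left: "l2_inner I (\<lambda>i. c * x i) z = c * l2_inner I x z"
  unfolding l2_inner_def by (simp add: mult.assoc infsum_cmult_right')

lemma l2_inner_uminus_left: "l2_inner I (\<lambda>i. - x i) z = - l2_inner I x z"
  using l2_inner_scale_left[of I "-1" x z] by simp

lemma l2_inner_diff_left:
  assumes "x \<in> l2 I" "y \<in> l2 I" "z \<in> l2 I"
  shows "l2_inner I (\<lambda>i. x i - y i) z = l2_inner I x z - l2_inner I y z"
  using l2_inner_add_left[OF assms(1) l2_uminus[OF assms(2)] assms(3)]
  by (simp add: l2_inner_uminus_left)

lemma l2_inner_minus_left:
  assumes "x \<in> l2 I" "y \<in> l2 I" "z \<in> l2 I"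
  shows "l2_inner I (x - y) z = l2_inner I x z - l2_inner I y z"
  using l2_inner_diff_left[OF assms] by (simp add: fun_diff_def)

lemma l2_inner_add_right:
  "x \<in> l2 I \<Longrightarrow> y \<in> l2 I \<Longrightarrow> z \<in> l2 I \<Longrightarrow>
    l2_inner I z (\<lambda>i. x i + y i) = l2_inner I z x + l2_inner I z y"
  by (simp add: l2_inner_cnj[of I z] l2_inner_add_left)

lemma l2_inner_diff_right:
  "x \<in> l2 I \<Longrightarrow> y \<in> l2 I \<Longrightarrow> z \<in> l2 I \<Longrightarrow>
    l2_inner I z (\<lambda>i. x i - y i) = l2_inner I z x - l2_inner I z y"
  by (simp add: l2_inner_cnj[of I z] l2_inner_diff_left)

lemma l2_inner_scale_right: "l2_inner I z (\<lambda>i. c * x i) = cnj c * l2_inner I z x"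
  by (simp add: l2_inner_cnj[of I z] l2_inner_scale_left)

lemma l2_inner_uminus_right: "l2_inner I z (\<lambda>i. - x i) = - l2_inner I z x"
  using l2_inner_scale_right[of I z "-1" x] by simp

lemma l2_inner_zero_right: "l2_inner I z (\<lambda>_. 0) = 0"
  by (simp add: l2_inner_def)

lemma l2_inner_self: "x \<in> l2 I \<Longrightarrow> l2_inner I x x = complex_of_real (l2_sq I x)"
proof -
  assume x: "x \<in> l2 I"
  have "l2_inner I x x = (\<Sum>\<^sub>\<infinity>i\<in>I. complex_of_real ((cmod (x i))\<^sup>2))"
    by (simp add: l2_inner_def complex_norm_square[symmetric])
  also have "\<dots> = complex_of_real (l2_sq I x)"
    unfolding l2_sq_def
    by (rule infsumI, rule has_sum_of_real, rule has_sum_infsum, rule l2_summable[OF x])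
  finally show ?thesis .
qed

lemma l2_inner_unit:
  assumes "k \<in> I" shows "l2_inner I x (l2_unit k) = x k"
proof -
  have "l2_inner I x (l2_unit k) = (\<Sum>\<^sub>\<infinity>i\<in>{k}. x i * cnj (l2_unit k i))"
    unfolding l2_inner_def by (rule infsum_cong_neutral) (use assms in \<open>auto simp: l2_unit_def\<close>)
  then show ?thesis by (simp add: l2_unit_def)
qed

lemma l2_sq_nonneg: "0 \<le> l2_sq I x"
  unfolding l2_sq_def by (rule infsum_nonneg) auto

lemma l2_sq_ge_sum:
  assumes "x \<in> l2 I" "finite F" "F \<subseteq> I" shows "(\<Sum>i\<in>F. (cmod (x i))\<^sup>2) \<le> l2_sq I x"
  unfolding l2_sq_def by (rule finite_sum_le_infsum) (use assms l2_summable in auto)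

lemma l2_sq_ge_coord:
  assumes "x \<in> l2 I" "i \<in> I" shows "(cmod (x i))\<^sup>2 \<le> l2_sq I x"
  using l2_sq_ge_sum[of x I "{i}"] assms by simp

lemma l2_sq_zeroD: "x \<in> l2 I \<Longrightarrow> l2_sq I x = 0 \<Longrightarrow> x = (\<lambda>_. 0)"
proof
  fix i assume x: "x \<in> l2 I" "l2_sq I x = 0"
  show "x i = 0"
  proof (cases "i \<in> I")
    case True
    then show ?thesis using l2_sq_ge_coord[OF x(1) True] x(2) by auto
  qed (rule l2_supp[OF x(1)])
qed

lemma l2_sq_add:
  assumes "x \<in> l2 I" "y \<in> l2 I"
  shows "l2_sq I (\<lambda>i. x i + y i) = l2_sq I x + l2_sq I y + 2 * Re (l2_inner I x y)"
proof -
  have "complex_of_real (l2_sq I (\<lambda>i. x i + y i)) = l2_inner I (\<lambda>i. x i + y i) (\<lambda>i. x i + y i)"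
    using l2_inner_self[OF l2_add[OF assms]] by simp
  also have "\<dots> = l2_sq I x + l2_sq I y + l2_inner I x y + cnj (l2_inner I x y)"
    using assms by (simp add: l2_inner_add_left l2_inner_add_right l2_add l2_inner_self
        l2_inner_cnj[of I y x])
  finally have "Re (complex_of_real (l2_sq I (\<lambda>i. x i + y i))) =
    Re (l2_sq I x + l2_sq I y + l2_inner I x y + cnj (l2_inner I x y))" by presburger
  then show ?thesis by simp
qed

lemma l2_sq_scale: "l2_sq I (\<lambda>i. c * x i) = (cmod c)\<^sup>2 * l2_sq I x"
  by (simp add: l2_sq_def norm_mult power_mult_distrib infsum_cmult_right')

lemma l2_parallelogram:
  assumes "x \<in> l2 I" "y \<in> l2 I"
  shows "l2_sq I (\<lambda>i. x i + y i) + l2_sq I (\<lambda>i. x i - y i) = 2 * l2_sq I x + 2 * l2_sq I y"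
proof -
  have "l2_sq I (\<lambda>i. - y i) = l2_sq I y" by (simp add: l2_sq_def)
  then show ?thesis
    using l2_sq_add[OF assms] l2_sq_add[OF assms(1) l2_uminus[OF assms(2)]]
    by (simp add: l2_inner_uminus_right)
qed

lemma l2_sq_add_le:
  assumes "x \<in> l2 I" "y \<in> l2 I"
  shows "l2_sq I (\<lambda>i. x i + y i) \<le> 2 * l2_sq I x + 2 * l2_sq I y"
  using l2_parallelogram[OF assms] l2_sq_nonneg[of I "\<lambda>i. x i - y i"] by linarith

text \<open>Fatou's lemma for sums: the bounds hold for finite partial sums, which pass to pointwise
  limits. This takes the place of completeness of \<open>l2 I\<close> when the limit of a minimizing
  sequence is formed.\<close>

lemma l2_fatou:
  assumes lim: "\<And>i. i \<in> I \<Longrightarrow> (\<lambda>n. y n i) \<longlonglongrightarrow> z i"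
    and y: "\<And>n. y n \<in> l2 I" and z: "\<And>i. i \<notin> I \<Longrightarrow> z i = 0"
    and bd: "\<And>n. l2_sq I (y n) \<le> B n" and B: "B \<longlonglongrightarrow> b"
  shows "z \<in> l2 I" "l2_sq I z \<le> b"
proof -
  have fin: "(\<Sum>i\<in>F. (cmod (z i))\<^sup>2) \<le> b" if F: "finite F" "F \<subseteq> I" for F
  proof (rule LIMSEQ_le)
    show "(\<lambda>n. \<Sum>i\<in>F. (cmod (y n i))\<^sup>2) \<longlonglongrightarrow> (\<Sum>i\<in>F. (cmod (z i))\<^sup>2)"
      by (intro tendsto_sum tendsto_power tendsto_norm lim) (use F in auto)
    show "\<exists>N. \<forall>n\<ge>N. (\<Sum>i\<in>F. (cmod (y n i))\<^sup>2) \<le> B n"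
      using l2_sq_ge_sum[OF y F] bd by (meson order_trans)
  qed fact
  have s: "(\<lambda>i. (cmod (z i))\<^sup>2) summable_on I"
    by (rule nonneg_bdd_above_summable_on) (auto intro!: bdd_aboveI[of _ b] fin)
  then show "z \<in> l2 I" using z by (auto simp: l2_def)
  show "l2_sq I z \<le> b"
    unfolding l2_sq_def by (rule infsum_le_finite_sums[OF s fin])
qed

section \<open>Closed subspaces and orthogonal projections\<close>

definition l2_closed_subspace :: "'i set \<Rightarrow> ('i \<Rightarrow> complex) set \<Rightarrow> bool" where
  "l2_closed_subspace I V \<longleftrightarrow> V \<subseteq> l2 I \<and> (\<lambda>_. 0) \<in> V \<and>
    (\<forall>x\<in>V. \<forall>y\<in>V. (\<lambda>i. x i + y i) \<in> V) \<and> (\<forall>c. \<forall>x\<in>V. (\<lambda>i. c * x i) \<in> V) \<and>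
    l2_closure I V \<subseteq> V"

lemma l2_norm_less_iff: "e > 0 \<Longrightarrow> l2_norm I x < e \<longleftrightarrow> l2_sq I x < e\<^sup>2"
  unfolding l2_norm_def l2_sq_def[symmetric]
  using real_sqrt_less_iff[of "l2_sq I x" "e\<^sup>2"] by simp

lemma l2_closureI:
  assumes "x \<in> l2 I" "\<And>e. e > 0 \<Longrightarrow> \<exists>a\<in>A. l2_sq I (\<lambda>i. x i - a i) < e"
  shows "x \<in> l2_closure I A"
  using assms by (auto simp: l2_closure_def l2_norm_less_iff fun_diff_def)

lemma l2_closureD:
  assumes "x \<in> l2_closure I A" "e > 0" shows "\<exists>a\<in>A. l2_sq I (\<lambda>i. x i - a i) < e"
proof -
  from assms obtain a where "a \<in> A" "l2_norm I (x - a) < sqrt e"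
    unfolding l2_closure_def by (auto dest: spec[of _ "sqrt e"])
  with assms(2) have "a \<in> A" "l2_sq I (x - a) < e" by (auto simp: l2_norm_less_iff)
  then show ?thesis by (auto simp: fun_diff_def)
qed

lemma l2_closure_l2: "x \<in> l2_closure I A \<Longrightarrow> x \<in> l2 I"
  by (simp add: l2_closure_def)

text \<open>Applied to the coboundaries: \<open>l2_proj\<close> is meaningful only on a closed
  subspace. The quarters in the proof absorb the factor 2 of \<open>l2_sq_add_le\<close>.\<close>

lemma l2_closed_subspace_closure:
  assumes sub: "V \<subseteq> l2 I" and z: "(\<lambda>_. 0) \<in> V"
    and add: "\<And>x y. x \<in> V \<Longrightarrow> y \<in> V \<Longrightarrow> (\<lambda>i. x i + y i) \<in> V"
    and scale: "\<And>c x. x \<in> V \<Longrightarrow> (\<lambda>i. c * x i) \<in> V"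
  shows "l2_closed_subspace I (l2_closure I V)"
  unfolding l2_closed_subspace_def
proof (intro conjI ballI allI)
  show "l2_closure I V \<subseteq> l2 I" using l2_closure_l2 by blast
  show "(\<lambda>_. 0) \<in> l2_closure I V"
    by (rule l2_closureI[OF l2_zero]) (auto intro!: bexI[OF _ z] simp: l2_sq_def)
next
  fix x y assume x: "x \<in> l2_closure I V" and y: "y \<in> l2_closure I V"
  show "(\<lambda>i. x i + y i) \<in> l2_closure I V"
  proof (rule l2_closureI)
    fix e :: real assume "e > 0"
    then obtain a b where ab: "a \<in> V" "b \<in> V" "l2_sq I (\<lambda>i. x i - a i) < e/4" "l2_sq I (\<lambda>i. y i - b i) < e/4"
      using l2_closureD[OF x, of "e/4"] l2_closureD[OF y, of "e/4"] by auto
    have "l2_sq I (\<lambda>i. (x i - a i) + (y i - b i)) \<le> 2 * l2_sq I (\<lambda>i. x i - a i) + 2 * l2_sq I (\<lambda>i. y i - b i)"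
      by (intro l2_sq_add_le l2_diff) (use x y ab sub l2_closure_l2 in auto)
    with ab have "l2_sq I (\<lambda>i. (x i + y i) - (a i + b i)) < e" by (simp add: algebra_simps)
    then show "\<exists>a\<in>V. l2_sq I (\<lambda>i. x i + y i - a i) < e"
      using add[OF ab(1,2)] by (intro bexI[of _ "\<lambda>i. a i + b i"])
  qed (intro l2_add l2_closure_l2[OF x] l2_closure_l2[OF y])
next
  fix c x assume x: "x \<in> l2_closure I V"
  show "(\<lambda>i. c * x i) \<in> l2_closure I V"
  proof (rule l2_closureI)
    fix e :: real assume e: "e > 0"
    \<comment> \<open>The summand 1 covers \<open>c = 0\<close>.\<close>
    define k where "k = (cmod c)\<^sup>2 + 1"
    have k: "k > 0" unfolding k_def by (simp add: add_nonneg_pos)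
    obtain a where a: "a \<in> V" "l2_sq I (\<lambda>i. x i - a i) < e/k"
      using l2_closureD[OF x, of "e/k"] e k by auto
    have "l2_sq I (\<lambda>i. c * x i - c * a i) = (cmod c)\<^sup>2 * l2_sq I (\<lambda>i. x i - a i)"
      using l2_sq_scale[of I c "\<lambda>i. x i - a i"] by (simp add: algebra_simps)
    also have "\<dots> \<le> k * l2_sq I (\<lambda>i. x i - a i)"
      unfolding k_def by (intro mult_right_mono l2_sq_nonneg) auto
    also have "\<dots> < e" using a k by (simp add: field_simps)
    finally show "\<exists>a\<in>V. l2_sq I (\<lambda>i. c * x i - a i) < e"
      using scale[OF a(1)] by (intro bexI[of _ "\<lambda>i. c * a i"])
  qed (intro l2_scale l2_closure_l2[OF x])
next
  show "l2_closure I (l2_closure I V) \<subseteq> l2_closure I V"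
  proof
    fix x assume x: "x \<in> l2_closure I (l2_closure I V)"
    show "x \<in> l2_closure I V"
    proof (rule l2_closureI)
      fix e :: real assume e: "e > 0"
      obtain a where a: "a \<in> l2_closure I V" "l2_sq I (\<lambda>i. x i - a i) < e/4"
        using l2_closureD[OF x, of "e/4"] e by auto
      obtain b where b: "b \<in> V" "l2_sq I (\<lambda>i. a i - b i) < e/4"
        using l2_closureD[OF a(1), of "e/4"] e by auto
      have "l2_sq I (\<lambda>i. (x i - a i) + (a i - b i)) \<le> 2 * l2_sq I (\<lambda>i. x i - a i) + 2 * l2_sq I (\<lambda>i. a i - b i)"
        by (intro l2_sq_add_le l2_diff) (use x a b sub l2_closure_l2 in auto)
      with a b have "l2_sq I (\<lambda>i. x i - b i) < e" by simp
      then show "\<exists>a\<in>V. l2_sq I (\<lambda>i. x i - a i) < e" using b by blast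
    qed (rule l2_closure_l2[OF x])
  qed
qed

text \<open>The best \<open>t\<close> is minus the inner product over \<open>l2_sq I v\<close>; the
  1 added to the denominator covers \<open>v = 0\<close>. Both a weak Cauchy-Schwarz inequality and
  orthogonality at a minimum follow.\<close>

lemma l2_descent:
  assumes x: "x \<in> l2 I" and v: "v \<in> l2 I"
  shows "\<exists>t. l2_sq I (\<lambda>i. x i + t * v i) \<le> l2_sq I x - (cmod (l2_inner I x v))\<^sup>2 / (l2_sq I v + 1)"
proof -
  let ?a = "l2_inner I x v"
  define k where "k = l2_sq I v + 1"
  have k: "k > 0" "l2_sq I v \<le> k" using l2_sq_nonneg[of I v] by (auto simp: k_def)
  define t where "t = - (?a / of_real k)"
  have "l2_sq I (\<lambda>i. x i + t * v i) = l2_sq I x + l2_sq I (\<lambda>i. t * v i) + 2 * Re (l2_inner I x (\<lambda>i. t * v i))"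
    by (rule l2_sq_add[OF x l2_scale[OF v]])
  also have "l2_sq I (\<lambda>i. t * v i) = (cmod ?a)\<^sup>2 / k\<^sup>2 * l2_sq I v"
    unfolding l2_sq_scale using k by (simp add: t_def norm_divide power_divide)
  also have "\<dots> \<le> (cmod ?a)\<^sup>2 / k\<^sup>2 * k" by (intro mult_left_mono) (use k in auto)
  also have "\<dots> = (cmod ?a)\<^sup>2 / k" by (simp add: power2_eq_square)
  also have "l2_inner I x (\<lambda>i. t * v i) = - of_real ((cmod ?a)\<^sup>2 / k)"
    unfolding l2_inner_scale_right by (simp add: t_def complex_norm_square[symmetric] mult.commute)
  finally show ?thesis unfolding k_def[symmetric] by (intro exI[of _ t]) simp
qed

text \<open>A squared norm after descent is still nonnegative. This weak form of Cauchy-Schwarz is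
  enough for continuity of the inner product in \<open>x\<close>.\<close>

lemma l2_inner_bound:
  assumes "x \<in> l2 I" "v \<in> l2 I"
  shows "(cmod (l2_inner I x v))\<^sup>2 \<le> (l2_sq I v + 1) * l2_sq I x"
proof -
  obtain t where "l2_sq I (\<lambda>i. x i + t * v i) \<le> l2_sq I x - (cmod (l2_inner I x v))\<^sup>2 / (l2_sq I v + 1)"
    using l2_descent[OF assms] by blast
  then have "(cmod (l2_inner I x v))\<^sup>2 / (l2_sq I v + 1) \<le> l2_sq I x"
    using l2_sq_nonneg[of I "\<lambda>i. x i + t * v i"] by linarith
  moreover have "l2_sq I v + 1 > 0" using l2_sq_nonneg[of I v] by linarith
  ultimately show ?thesis by (simp add: field_simps)
qed

lemma l2_inner_eq_0_if_minimal:
  assumes "x \<in> l2 I" "v \<in> l2 I"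
    and min: "\<And>t. l2_sq I x \<le> l2_sq I (\<lambda>i. x i + t * v i)"
  shows "l2_inner I x v = 0"
proof -
  obtain t where "l2_sq I (\<lambda>i. x i + t * v i) \<le> l2_sq I x - (cmod (l2_inner I x v))\<^sup>2 / (l2_sq I v + 1)"
    using l2_descent[OF assms(1,2)] by blast
  then have "(cmod (l2_inner I x v))\<^sup>2 / (l2_sq I v + 1) \<le> 0" using min[of t] by linarith
  moreover have "l2_sq I v + 1 > 0" using l2_sq_nonneg[of I v] by linarith
  ultimately show ?thesis by (simp add: field_simps)
qed

text \<open>Hilbert's projection theorem: a sequence in \<open>V\<close> minimizing the distance to
  \<open>x\<close> is Cauchy by the parallelogram law and converges coordinatewise; its limit lies
  in \<open>V\<close> and is a minimizer, and minimality gives orthogonality.\<close>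

lemma l2_projection_exists:
  assumes V: "l2_closed_subspace I V" and x: "x \<in> l2 I"
  shows "\<exists>p\<in>V. \<forall>v\<in>V. l2_inner I (x - p) v = 0"
proof -
  have sub: "\<And>v. v \<in> V \<Longrightarrow> v \<in> l2 I" and z: "(\<lambda>_. 0) \<in> V"
    and add: "\<And>x y. x \<in> V \<Longrightarrow> y \<in> V \<Longrightarrow> (\<lambda>i. x i + y i) \<in> V"
    and scale: "\<And>c x. x \<in> V \<Longrightarrow> (\<lambda>i. c * x i) \<in> V"
    and cl: "l2_closure I V \<subseteq> V"
    using V by (auto simp: l2_closed_subspace_def)
  define d where "d = (INF v\<in>V. l2_sq I (\<lambda>i. x i - v i))"
  have bdd: "bdd_below ((\<lambda>v. l2_sq I (\<lambda>i. x i - v i)) ` V)"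
    by (auto intro!: bdd_belowI[of _ 0] l2_sq_nonneg)
  have d: "d \<le> l2_sq I (\<lambda>i. x i - v i)" if "v \<in> V" for v
    unfolding d_def using cINF_lower[OF bdd that] .
  have "\<exists>v\<in>V. l2_sq I (\<lambda>i. x i - v i) < d + inverse (real (Suc n))" for n
  proof -
    have "d < d + inverse (real (Suc n))" by simp
    then show ?thesis unfolding d_def using cINF_less_iff[OF _ bdd] z by blast
  qed
  then obtain w where w: "\<And>n. w n \<in> V" "\<And>n. l2_sq I (\<lambda>i. x i - w n i) < d + inverse (real (Suc n))"
    by metis
  have xw: "(\<lambda>i. x i - w n i) \<in> l2 I" for n using l2_diff[OF x sub[OF w(1)]] .
  have cau: "l2_sq I (\<lambda>i. w n i - w m i) \<le> 2 * inverse (real (Suc n)) + 2 * inverse (real (Suc m))" for n m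
  proof -
    \<comment> \<open>The midpoint lies in \<open>V\<close>, so its squared distance from
      \<open>x\<close> is at least \<open>d\<close>; the parallelogram law then forces
      \<open>w n\<close> and \<open>w m\<close> together.\<close>
    let ?h = "\<lambda>i. (1/2) * (w n i + w m i)"
    have "l2_sq I (\<lambda>i. (x i - w m i) + (x i - w n i)) = l2_sq I (\<lambda>i. 2 * (x i - ?h i))"
      by (simp add: algebra_simps)
    also have "\<dots> = 4 * l2_sq I (\<lambda>i. x i - ?h i)" by (subst l2_sq_scale) simp
    also have "\<dots> \<ge> 4 * d" using d[OF scale[OF add[OF w(1) w(1)]], of "1/2" n m] by simp
    finally have "4 * d \<le> l2_sq I (\<lambda>i. (x i - w m i) + (x i - w n i))" .
    then show ?thesis using l2_parallelogram[OF xw[of m] xw[of n]] w(2)[of n] w(2)[of m] by simp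
  qed
  have inv0: "(\<lambda>n. inverse (real (Suc n))) \<longlonglongrightarrow> 0" by (rule LIMSEQ_inverse_real_of_nat)
  have "\<exists>l. (\<lambda>n. w n i) \<longlonglongrightarrow> l" if i: "i \<in> I" for i
  proof -
    have "Cauchy (\<lambda>n. w n i)"
    proof (rule metric_CauchyI)
      fix e :: real assume e: "e > 0"
      have "eventually (\<lambda>n. inverse (real (Suc n)) < e\<^sup>2/4) sequentially"
        using order_tendstoD(2)[OF inv0, of "e\<^sup>2/4"] e by simp
      then obtain M where M: "\<And>n. n \<ge> M \<Longrightarrow> inverse (real (Suc n)) < e\<^sup>2/4"
        by (auto simp: eventually_sequentially)
      have "dist (w m i) (w n i) < e" if mn: "m \<ge> M" "n \<ge> M" for m n
      proof -
        have "(cmod (w m i - w n i))\<^sup>2 \<le> l2_sq I (\<lambda>i. w m i - w n i)"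
          by (rule l2_sq_ge_coord[OF l2_diff]) (use sub w i in auto)
        also have "\<dots> < e\<^sup>2" using cau[of m n] M[OF mn(1)] M[OF mn(2)] by simp
        finally show ?thesis unfolding dist_norm using e power_less_imp_less_base by (metis less_imp_le)
      qed
      then show "\<exists>M. \<forall>m\<ge>M. \<forall>n\<ge>M. dist (w m i) (w n i) < e" by blast
    qed
    then show ?thesis using Cauchy_convergent convergent_def by blast
  qed
  then obtain q where q: "\<And>i. i \<in> I \<Longrightarrow> (\<lambda>n. w n i) \<longlonglongrightarrow> q i" by metis
  \<comment> \<open>Membership in \<open>l2 I\<close> demands the value 0 off
    \<open>I\<close>.\<close>
  define p where "p = (\<lambda>i. if i \<in> I then q i else 0)"
  have p: "\<And>i. i \<in> I \<Longrightarrow> (\<lambda>n. w n i) \<longlonglongrightarrow> p i" using q by (simp add: p_def)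
  have xp: "(\<lambda>i. x i - p i) \<in> l2 I" "l2_sq I (\<lambda>i. x i - p i) \<le> d"
  proof -
    have B: "(\<lambda>n. d + inverse (real (Suc n))) \<longlonglongrightarrow> d"
      using tendsto_add[OF tendsto_const[of d] inv0] by simp
    have lim: "(\<lambda>n. x i - w n i) \<longlonglongrightarrow> x i - p i" if "i \<in> I" for i
      by (intro tendsto_diff tendsto_const p that)
    have supp: "x i - p i = 0" if "i \<notin> I" for i
      using that l2_supp[OF x that] by (simp add: p_def)
    show "(\<lambda>i. x i - p i) \<in> l2 I" "l2_sq I (\<lambda>i. x i - p i) \<le> d"
      using l2_fatou[of I "\<lambda>n i. x i - w n i" "\<lambda>i. x i - p i", OF lim xw supp less_imp_le[OF w(2)] B]
      by auto
  qed
  have pl: "p \<in> l2 I" using l2_diff[OF x xp(1)] by simp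
  \<comment> \<open>Fatou with \<open>n\<close> fixed and \<open>m\<close> tending to infinity
    upgrades coordinatewise convergence to convergence in norm, so that closedness of
    \<open>V\<close> applies.\<close>
  have pw: "l2_sq I (\<lambda>i. p i - w n i) \<le> 2 * inverse (real (Suc n))" for n
  proof (rule l2_fatou(2)[of I "\<lambda>m i. w m i - w n i"])
    show "(\<lambda>m. 2 * inverse (real (Suc m)) + 2 * inverse (real (Suc n))) \<longlonglongrightarrow> 2 * inverse (real (Suc n))"
      using tendsto_add[OF tendsto_mult_right[OF inv0, of 2] tendsto_const[of "2 * inverse (real (Suc n))"]] 
      by (simp add: mult.commute)
    show "(\<lambda>m. w m i - w n i) \<longlonglongrightarrow> p i - w n i" if "i \<in> I" for i
      by (intro tendsto_diff tendsto_const p that)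
    show "p i - w n i = 0" if "i \<notin> I" for i
      using that l2_supp[OF sub[OF w(1)] that] by (simp add: p_def)
  qed (rule l2_diff[OF sub[OF w(1)] sub[OF w(1)]], rule cau)
  have pV: "p \<in> V"
  proof (rule subsetD[OF cl], rule l2_closureI[OF pl])
    fix e :: real assume e: "e > 0"
    obtain n where "inverse (real (Suc n)) < e/2" using reals_Archimedean[of "e/2"] e by auto
    then show "\<exists>a\<in>V. l2_sq I (\<lambda>i. p i - a i) < e" using pw[of n] w(1)[of n] by (intro bexI[of _ "w n"]) auto
  qed
  have "l2_inner I (\<lambda>i. x i - p i) v = 0" if v: "v \<in> V" for v
  proof (rule l2_inner_eq_0_if_minimal[OF xp(1) sub[OF v]])
    fix t
    have "(\<lambda>i. p i + (-t) * v i) \<in> V" by (intro add pV scale v)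
    from d[OF this] xp(2) show "l2_sq I (\<lambda>i. x i - p i) \<le> l2_sq I (\<lambda>i. x i - p i + t * v i)"
      by (simp add: algebra_simps)
  qed
  with pV show ?thesis by (auto simp: fun_diff_def)
qed

context
  fixes I :: "'i set" and V
  assumes V: "l2_closed_subspace I V"
begin

lemma l2_closed_subspace_l2: "v \<in> V \<Longrightarrow> v \<in> l2 I"
  using V by (auto simp: l2_closed_subspace_def)

lemma l2_closed_subspace_scale: "v \<in> V \<Longrightarrow> (\<lambda>i. c * v i) \<in> V"
  using V by (simp add: l2_closed_subspace_def)

lemma l2_closed_subspace_add: "v \<in> V \<Longrightarrow> w \<in> V \<Longrightarrow> (\<lambda>i. v i + w i) \<in> V"
  using V by (simp add: l2_closed_subspace_def)

lemma l2_closed_subspace_diff: "v \<in> V \<Longrightarrow> w \<in> V \<Longrightarrow> (\<lambda>i. v i - w i) \<in> V"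
  using l2_closed_subspace_add[OF _ l2_closed_subspace_scale, of v w "-1"] by simp

text \<open>The difference of two candidates lies in \<open>V\<close> and is orthogonal to itself.
  This settles the definite description in \<open>l2_proj\<close>.\<close>

lemma l2_proj_unique:
  assumes x: "x \<in> l2 I" and p: "p \<in> V" "\<And>v. v \<in> V \<Longrightarrow> l2_inner I (x - p) v = 0"
  shows "l2_proj I V x = p"
  unfolding l2_proj_def
proof (rule the_equality)
  fix q assume q: "q \<in> V \<and> (\<forall>v\<in>V. l2_inner I (x - q) v = 0)"
  let ?d = "\<lambda>i. q i - p i"
  have d: "?d \<in> V" using l2_closed_subspace_diff q p(1) by simp
  have l: "p \<in> l2 I" "q \<in> l2 I" "?d \<in> l2 I" using p(1) q d l2_closed_subspace_l2 by auto
  have "l2_inner I (x - p) ?d - l2_inner I (x - q) ?d = 0" using p(2)[OF d] q d by simp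
  then have "l2_inner I ?d ?d = 0"
    using l x by (simp add: l2_inner_minus_left l2_inner_diff_left)
  then have "l2_sq I ?d = 0" using l2_inner_self[OF l(3)] by simp
  from l2_sq_zeroD[OF l(3) this] show "q = p" by (simp add: fun_eq_iff)
qed (use p in auto)

lemma l2_proj_in: "x \<in> l2 I \<Longrightarrow> l2_proj I V x \<in> V"
  and l2_proj_orth: "x \<in> l2 I \<Longrightarrow> v \<in> V \<Longrightarrow> l2_inner I (x - l2_proj I V x) v = 0"
proof -
  assume x: "x \<in> l2 I"
  obtain p where p: "p \<in> V" "\<And>v. v \<in> V \<Longrightarrow> l2_inner I (x - p) v = 0"
    using l2_projection_exists[OF V x] by blast
  have eq: "l2_proj I V x = p" by (rule l2_proj_unique[OF x p])
  show "l2_proj I V x \<in> V" using p(1) eq by simp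
  show "v \<in> V \<Longrightarrow> l2_inner I (x - l2_proj I V x) v = 0" using p(2) eq by simp
qed

lemma l2_inner_proj_left:
  assumes "x \<in> l2 I" "v \<in> V" shows "l2_inner I (l2_proj I V x) v = l2_inner I x v"
  using l2_proj_orth[OF assms] l2_closed_subspace_l2[OF l2_proj_in[OF assms(1)]]
    assms l2_closed_subspace_l2[OF assms(2)]
  by (simp add: l2_inner_minus_left)

lemma l2_inner_proj_right:
  assumes "x \<in> l2 I" "v \<in> V" shows "l2_inner I v (l2_proj I V x) = l2_inner I v x"
  using l2_inner_proj_left[OF assms] by (simp add: l2_inner_cnj[of I v])

text \<open>An orthogonal projection is self-adjoint and idempotent. The identity yields the bounds
  0 and 1 for diagonal entries and the hypothesis \<open>contr\<close> of
  \<open>trace_le_rank\<close>.\<close>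

lemma l2_proj_unit_diag:
  assumes k: "k \<in> I"
  shows "l2_proj I V (l2_unit k) k = of_real (l2_sq I (l2_proj I V (l2_unit k)))"
proof -
  let ?p = "l2_proj I V (l2_unit k)"
  have p: "?p \<in> V" using l2_proj_in[OF l2_unit[OF k]] .
  have "?p k = l2_inner I ?p (l2_unit k)" using l2_inner_unit[OF k] by simp
  also have "\<dots> = l2_inner I ?p ?p" using l2_inner_proj_right[OF l2_unit[OF k] p] by simp
  finally show ?thesis using l2_inner_self[OF l2_closed_subspace_l2[OF p]] by simp
qed

lemma l2_proj_unit_diag_bounds:
  assumes k: "k \<in> I"
  shows "0 \<le> Re (l2_proj I V (l2_unit k) k)" "Re (l2_proj I V (l2_unit k) k) \<le> 1"
proof -
  let ?p = "l2_proj I V (l2_unit k)"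
  let ?n = "l2_sq I ?p"
  show "0 \<le> Re (?p k)" using l2_proj_unit_diag[OF k] l2_sq_nonneg by simp
  have "(cmod (?p k))\<^sup>2 \<le> ?n"
    using l2_sq_ge_coord[OF l2_closed_subspace_l2[OF l2_proj_in[OF l2_unit[OF k]]] k] .
  \<comment> \<open>The coordinate of \<open>?p\<close> at \<open>k\<close> is \<open>?n\<close>
    itself, and its square is bounded by the squared norm \<open>?n\<close>.\<close>
  then have "?n\<^sup>2 \<le> ?n" using l2_proj_unit_diag[OF k] by simp
  then have "?n \<le> 1" using l2_sq_nonneg[of I ?p]
    by (cases "?n = 0") (auto simp: power2_eq_square)
  then show "Re (?p k) \<le> 1" using l2_proj_unit_diag[OF k] by simp
qed

end

text \<open>If \<open>a\<close> annihilates \<open>m\<close>, then \<open>x\<close> and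
  \<open>x - a\<close> have the same inner product with \<open>m\<close>, which
  \<open>l2_inner_bound\<close> makes small when \<open>a\<close> is close to \<open>x\<close>. The
  cocycle space is later shown to be closed by writing it as an annihilator.\<close>

lemma l2_closed_subspace_annihilator:
  assumes M: "M \<subseteq> l2 I"
  shows "l2_closed_subspace I {v \<in> l2 I. \<forall>m\<in>M. l2_inner I v m = 0}"
proof -
  have ml: "m \<in> M \<Longrightarrow> m \<in> l2 I" for m using M by auto
  show ?thesis
    unfolding l2_closed_subspace_def
  proof (intro conjI ballI allI subsetI)
    fix x assume x: "x \<in> l2_closure I {v \<in> l2 I. \<forall>m\<in>M. l2_inner I v m = 0}"
    have xl: "x \<in> l2 I" using l2_closure_l2[OF x] .
    have "l2_inner I x m = 0" if m: "m \<in> M" for m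
    proof (rule ccontr)
      let ?a = "l2_inner I x m"
      have mI: "m \<in> l2 I" by (rule ml[OF m])
      have k: "l2_sq I m + 1 > 0" using l2_sq_nonneg[of I m] by linarith
      assume "?a \<noteq> 0"
      then have "(cmod ?a)\<^sup>2 / (l2_sq I m + 1) > 0" using k by simp
      from l2_closureD[OF x this] obtain a where a: "a \<in> l2 I" "l2_inner I a m = 0"
        "l2_sq I (\<lambda>i. x i - a i) < (cmod ?a)\<^sup>2 / (l2_sq I m + 1)" using m by blast
      have "?a = l2_inner I (\<lambda>i. x i - a i) m" using l2_inner_diff_left[OF xl a(1) mI] a(2) by simp
      then have "(cmod ?a)\<^sup>2 \<le> (l2_sq I m + 1) * l2_sq I (\<lambda>i. x i - a i)"
        using l2_inner_bound[OF l2_diff[OF xl a(1)] mI] by simp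
      with a(3) k show False by (simp add: field_simps)
    qed
    with xl show "x \<in> {v \<in> l2 I. \<forall>m\<in>M. l2_inner I v m = 0}" by simp
  qed (auto simp: ml l2_zero l2_add l2_scale l2_inner_add_left l2_inner_scale_left l2_inner_def[of _ "\<lambda>_. 0"])
qed

section \<open>Finite direct sums of l2 spaces\<close>

lemma has_sum_Times_finite:
  fixes f :: "'a \<times> 'b \<Rightarrow> 'c::topological_comm_monoid_add"
  assumes "finite S" "\<And>s. s \<in> S \<Longrightarrow> ((\<lambda>x. f (s, x)) has_sum a s) H"
  shows "(f has_sum (\<Sum>s\<in>S. a s)) (S \<times> H)"
  using assms
proof (induction S rule: finite_induct)
  case (insert s S)
  have "((\<lambda>x. f (s, x)) has_sum a s) H \<longleftrightarrow> (f has_sum a s) ({s} \<times> H)"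
    by (rule has_sum_reindex_bij_betw) (auto simp: bij_betw_def inj_on_def)
  then have "(f has_sum (a s + (\<Sum>s\<in>S. a s))) ({s} \<times> H \<union> S \<times> H)"
    using insert by (intro has_sum_Un_disjoint) auto
  moreover have "{s} \<times> H \<union> S \<times> H = insert s S \<times> H" by auto
  ultimately show ?case using insert by simp
qed simp

lemma l2_slice:
  assumes "v \<in> l2 (S \<times> H)" "s \<in> S" shows "(\<lambda>x. v (s, x)) \<in> l2 H"
proof -
  have "(\<lambda>i. (cmod (v i))\<^sup>2) summable_on ({s} \<times> H)"
    by (rule summable_on_subset_banach[OF l2_summable[OF assms(1)]]) (use assms in auto)
  moreover have "(\<lambda>x. (cmod (v (s, x)))\<^sup>2) summable_on H \<longleftrightarrow> (\<lambda>i. (cmod (v i))\<^sup>2) summable_on ({s} \<times> H)"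
    by (rule summable_on_reindex_bij_betw) (auto simp: bij_betw_def inj_on_def)
  ultimately show ?thesis using l2_supp[OF assms(1)] by (auto simp: l2_def)
qed

lemma l2_TimesI:
  assumes "finite S" "\<And>s. s \<in> S \<Longrightarrow> (\<lambda>x. v (s, x)) \<in> l2 H" "\<And>s x. s \<notin> S \<Longrightarrow> v (s, x) = 0"
  shows "v \<in> l2 (S \<times> H)"
proof -
  have "((\<lambda>i. (cmod (v i))\<^sup>2) has_sum (\<Sum>s\<in>S. l2_sq H (\<lambda>x. v (s, x)))) (S \<times> H)"
    by (rule has_sum_Times_finite) (use assms in \<open>auto simp: l2_sq_def intro!: has_sum_infsum l2_summable\<close>)
  moreover have "v (s, x) = 0" if "(s, x) \<notin> S \<times> H" for s x
    using that assms(3)[of s x] l2_supp[OF assms(2)[of s], of x] by auto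
  ultimately show ?thesis by (auto simp: l2_def has_sum_imp_summable)
qed

lemma l2_inner_Times:
  assumes "finite S" "v \<in> l2 (S \<times> H)" "w \<in> l2 (S \<times> H)"
  shows "l2_inner (S \<times> H) v w = (\<Sum>s\<in>S. l2_inner H (\<lambda>x. v (s, x)) (\<lambda>x. w (s, x)))"
  unfolding l2_inner_def
  by (rule infsumI, rule has_sum_Times_finite)
    (use assms in \<open>auto intro!: has_sum_infsum l2_inner_summable l2_slice\<close>)

section \<open>Trace and rank of a contraction\<close>

lemma sum_mult_cnj_self: "(\<Sum>i\<in>E. f i * cnj (f i)) = complex_of_real (\<Sum>i\<in>E. (cmod (f i))\<^sup>2)"
  by (simp add: complex_norm_square[symmetric])

text \<open>Induction on \<open>Y\<close>: the residue \<open>r\<close> of the new vector after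
  removing its components along the \<open>u j\<close> either vanishes on \<open>E\<close>, or is
  normalized and appended with index \<open>k\<close>.\<close>

lemma gram_schmidt:
  fixes D :: "'y \<Rightarrow> 'e \<Rightarrow> complex"
  assumes E: "finite E" and Y: "finite Y"
  shows "\<exists>k\<le>card Y. \<exists>u :: nat \<Rightarrow> 'e \<Rightarrow> complex.
    (\<forall>i<k. \<forall>j<k. (\<Sum>e\<in>E. u i e * cnj (u j e)) = (if i = j then 1 else 0)) \<and>
    (\<forall>y\<in>Y. \<exists>c. \<forall>e\<in>E. D y e = (\<Sum>j<k. c j * u j e))"
  using Y
proof (induction Y rule: finite_induct)
  case empty
  show ?case by auto
next
  case (insert y Y)
  then obtain k u where k: "k \<le> card Y"
    and on: "\<And>i j. i < k \<Longrightarrow> j < k \<Longrightarrow> (\<Sum>e\<in>E. u i e * cnj (u j e)) = (if i = j then 1 else 0)"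
    and sp: "\<And>y. y \<in> Y \<Longrightarrow> \<exists>c. \<forall>e\<in>E. D y e = (\<Sum>j<k. c j * u j e)"
    by blast
  define c where "c j = (\<Sum>e\<in>E. D y e * cnj (u j e))" for j
  define r where "r e = D y e - (\<Sum>j<k. c j * u j e)" for e
  define n where "n = sqrt (\<Sum>e\<in>E. (cmod (r e))\<^sup>2)"
  have orth: "(\<Sum>e\<in>E. r e * cnj (u i e)) = 0" if i: "i < k" for i
  proof -
    have "(\<Sum>e\<in>E. (\<Sum>j<k. c j * u j e) * cnj (u i e)) = (\<Sum>j<k. c j * (\<Sum>e\<in>E. u j e * cnj (u i e)))"
      by (simp add: sum_distrib_right sum_distrib_left mult.assoc) (rule sum.swap)
    also have "\<dots> = (\<Sum>j<k. c j * (if j = i then 1 else 0))"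
      by (rule sum.cong) (use on i in auto)
    also have "\<dots> = c i"
      using i by (simp add: if_distrib[of "\<lambda>x. _ * x"] sum.delta cong: if_cong)
    finally show ?thesis by (simp add: r_def algebra_simps sum_subtractf c_def)
  qed
  show ?case
  proof (cases "n = 0")
    case True
    then have "\<forall>e\<in>E. (cmod (r e))\<^sup>2 = 0"
      unfolding n_def by (subst (asm) real_sqrt_eq_zero_cancel_iff, subst (asm) sum_nonneg_eq_0_iff) (use E in auto)
    then have "\<forall>e\<in>E. D y e = (\<Sum>j<k. c j * u j e)" by (auto simp: r_def)
    with k on sp insert show ?thesis
      by (intro exI[of _ k] conjI exI[of _ u]) (auto simp: le_SucI)
  next
    case False
    define u' where "u' = u(k := (\<lambda>e. r e / of_real n))"
    have nn: "(\<Sum>e\<in>E. r e * cnj (r e)) = of_real n * of_real n"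
    proof -
      have "n * n = (\<Sum>e\<in>E. (cmod (r e))\<^sup>2)" unfolding n_def by (simp add: sum_nonneg)
      then show ?thesis unfolding sum_mult_cnj_self of_real_mult[symmetric] by (rule arg_cong[OF sym])
    qed
    have orth': "(\<Sum>e\<in>E. u i e * cnj (r e)) = 0" if i: "i < k" for i
    proof -
      have "(\<Sum>e\<in>E. u i e * cnj (r e)) = cnj (\<Sum>e\<in>E. r e * cnj (u i e))" by (simp add: mult.commute)
      with orth[OF i] show ?thesis by simp
    qed
    have "(\<Sum>e\<in>E. u' i e * cnj (u' j e)) = (if i = j then 1 else 0)" if ij: "i < Suc k" "j < Suc k" for i j
    proof -
      consider "i < k" "j < k" | "i = k" "j < k" | "i < k" "j = k" | "i = k" "j = k"
        using ij by linarith
      then show ?thesis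
      proof cases
        case 2
        then show ?thesis using orth[of j] by (simp add: u'_def sum_divide_distrib[symmetric])
      next
        case 3
        then show ?thesis using orth'[of i] by (simp add: u'_def sum_divide_distrib[symmetric])
      next
        case 4
        then show ?thesis using nn False by (simp add: u'_def sum_divide_distrib[symmetric])
      qed (simp add: u'_def on)
    qed
    moreover have "\<exists>d. \<forall>e\<in>E. D z e = (\<Sum>j<Suc k. d j * u' j e)" if z: "z \<in> insert y Y" for z
    proof (cases "z = y")
      case True
      have "\<forall>e\<in>E. D z e = (\<Sum>j<Suc k. (c(k := of_real n)) j * u' j e)"
        using False True by (simp add: u'_def r_def)
      then show ?thesis by blast
    next
      case zy: False
      then obtain d where "\<forall>e\<in>E. D z e = (\<Sum>j<k. d j * u j e)" using sp z by blast
      then have "\<forall>e\<in>E. D z e = (\<Sum>j<Suc k. (d(k := 0)) j * u' j e)"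
        by (simp add: u'_def)
      then show ?thesis by blast
    qed
    ultimately show ?thesis using k insert
      by (intro exI[of _ "Suc k"] conjI exI[of _ u']) auto
  qed
qed

text \<open>The hypothesis on \<open>a\<close> is satisfied by the matrix of any compression of an orthogonal
  projection, so this bounds the trace of a positive contraction by its rank.\<close>

lemma trace_le_rank:
  fixes D :: "'y \<Rightarrow> 'e \<Rightarrow> complex" and a :: "'e \<Rightarrow> 'e \<Rightarrow> complex"
  assumes E: "finite E" and Y: "finite Y"
    and span: "\<And>e. e \<in> E \<Longrightarrow> \<exists>b. \<forall>i\<in>E. a e i = (\<Sum>y\<in>Y. b y * D y i)"
    and contr: "\<And>e. e \<in> E \<Longrightarrow> (\<Sum>i\<in>E. (cmod (a e i))\<^sup>2) \<le> Re (a e e)"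
  shows "(\<Sum>e\<in>E. Re (a e e)) \<le> card Y"
proof -
  obtain k u where k: "k \<le> card Y"
    and on: "\<And>i j. i < k \<Longrightarrow> j < k \<Longrightarrow> (\<Sum>e\<in>E. u i e * cnj (u j e)) = (if i = j then 1 else 0)"
    and sp: "\<And>y. y \<in> Y \<Longrightarrow> \<exists>c. \<forall>e\<in>E. D y e = (\<Sum>j<k. c j * u j e)"
    using gram_schmidt[OF E Y, of D] by blast
  have "\<forall>y\<in>Y. \<exists>c. \<forall>e\<in>E. D y e = (\<Sum>j<k. c j * u j e)" using sp by (rule ballI)
  from bchoice[OF this] obtain c where "\<forall>y\<in>Y. \<forall>e\<in>E. D y e = (\<Sum>j<k. c y j * u j e)" ..
  then have c: "D y e = (\<Sum>j<k. c y j * u j e)" if "y \<in> Y" "e \<in> E" for y e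
    using that by simp
  \<comment> \<open>Let \<open>d\<close> be the coordinates of row \<open>e\<close> in the
    orthonormal system. Their squares sum to the squared norm of the row, at most the diagonal entry
    by \<open>contr\<close>. That entry is also the sum of the \<open>d j * u j e\<close>, so
    bounding twice each product by the sum of two squares leaves the stated estimate.\<close>
  have le: "Re (a e e) \<le> (\<Sum>j<k. (cmod (u j e))\<^sup>2)" if e: "e \<in> E" for e
  proof -
    obtain b where b: "\<And>i. i \<in> E \<Longrightarrow> a e i = (\<Sum>y\<in>Y. b y * D y i)" using span[OF e] by blast
    define d where "d j = (\<Sum>y\<in>Y. b y * c y j)" for j
    have d: "a e i = (\<Sum>j<k. d j * u j i)" if i: "i \<in> E" for i
    proof -
      have "a e i = (\<Sum>y\<in>Y. \<Sum>j<k. b y * (c y j * u j i))"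
        using b[OF i] by (simp add: c i sum_distrib_left)
      also have "\<dots> = (\<Sum>j<k. \<Sum>y\<in>Y. b y * (c y j * u j i))" by (rule sum.swap)
      finally show ?thesis by (simp add: d_def sum_distrib_right mult.assoc)
    qed
    have "complex_of_real (\<Sum>i\<in>E. (cmod (a e i))\<^sup>2) = (\<Sum>i\<in>E. a e i * cnj (a e i))"
      by (rule sum_mult_cnj_self[symmetric])
    also have "\<dots> = (\<Sum>i\<in>E. (\<Sum>j<k. d j * u j i) * (\<Sum>l<k. cnj (d l) * cnj (u l i)))"
      by (rule sum.cong) (simp_all add: d)
    also have "\<dots> = (\<Sum>i\<in>E. \<Sum>j<k. \<Sum>l<k. (d j * cnj (d l)) * (u j i * cnj (u l i)))"
      by (simp add: sum_product mult_ac)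
    also have "\<dots> = (\<Sum>j<k. \<Sum>i\<in>E. \<Sum>l<k. (d j * cnj (d l)) * (u j i * cnj (u l i)))"
      by (rule sum.swap)
    also have "\<dots> = (\<Sum>j<k. \<Sum>l<k. \<Sum>i\<in>E. (d j * cnj (d l)) * (u j i * cnj (u l i)))"
      by (intro sum.cong refl sum.swap)
    also have "\<dots> = (\<Sum>j<k. \<Sum>l<k. (d j * cnj (d l)) * (\<Sum>i\<in>E. u j i * cnj (u l i)))"
      by (simp add: sum_distrib_left)
    also have "\<dots> = (\<Sum>j<k. \<Sum>l<k. (d j * cnj (d l)) * (if j = l then 1 else 0))"
      by (intro sum.cong refl) (simp add: on)
    also have "\<dots> = (\<Sum>j<k. d j * cnj (d j))" 
      by (intro sum.cong refl) (simp add: if_distrib[of "\<lambda>x. _ * x"] sum.delta' cong: if_cong)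
    also have "\<dots> = complex_of_real (\<Sum>j<k. (cmod (d j))\<^sup>2)" by (rule sum_mult_cnj_self)
    finally have "(\<Sum>i\<in>E. (cmod (a e i))\<^sup>2) = (\<Sum>j<k. (cmod (d j))\<^sup>2)" by (simp only: of_real_eq_iff)
    with contr[OF e] have n: "(\<Sum>j<k. (cmod (d j))\<^sup>2) \<le> Re (a e e)" by simp
    have "2 * Re (a e e) = (\<Sum>j<k. 2 * Re (d j * u j e))" by (simp add: d[OF e] sum_distrib_left)
    also have "\<dots> \<le> (\<Sum>j<k. (cmod (d j))\<^sup>2 + (cmod (u j e))\<^sup>2)"
    proof (rule sum_mono)
      fix j
      have "Re (d j * u j e) \<le> cmod (d j) * cmod (u j e)" by (metis complex_Re_le_cmod norm_mult)
      then show "2 * Re (d j * u j e) \<le> (cmod (d j))\<^sup>2 + (cmod (u j e))\<^sup>2"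
        using sum_squares_bound[of "cmod (d j)" "cmod (u j e)"] by simp
    qed
    also have "\<dots> \<le> Re (a e e) + (\<Sum>j<k. (cmod (u j e))\<^sup>2)" using n by (simp add: sum.distrib)
    finally show ?thesis by simp
  qed
  have one: "(\<Sum>e\<in>E. (cmod (u j e))\<^sup>2) = 1" if "j < k" for j
  proof -
    have "complex_of_real (\<Sum>e\<in>E. (cmod (u j e))\<^sup>2) = 1"
      using on[OF that that] by (simp only: sum_mult_cnj_self[symmetric] if_True refl)
    then show ?thesis by (simp only: of_real_eq_1_iff)
  qed
  have "(\<Sum>e\<in>E. Re (a e e)) \<le> (\<Sum>e\<in>E. \<Sum>j<k. (cmod (u j e))\<^sup>2)" by (rule sum_mono) (rule le)
  also have "\<dots> = (\<Sum>j<k. \<Sum>e\<in>E. (cmod (u j e))\<^sup>2)" by (rule sum.swap)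
  also have "\<dots> = k" by (simp add: one)
  finally show ?thesis using k by simp
qed

section \<open>The space of cocycles\<close>

text \<open>The right regular action, which commutes with the left translations in the cocycle
  identity. The value 0 off \<open>H\<close> respects the support condition of
  \<open>l2\<close>.\<close>

definition rshift :: "('g, 'b) monoid_scheme \<Rightarrow> 'g set \<Rightarrow> 'g \<Rightarrow> ('g \<times> 'g \<Rightarrow> complex) \<Rightarrow> 'g \<times> 'g \<Rightarrow> complex" where
  "rshift G H h v = (\<lambda>(s, x). if x \<in> H then v (s, x \<otimes>\<^bsub>G\<^esub> h) else 0)"

context group
begin

lemma subgroup_bij_right:
  assumes "subgroup H G" "h \<in> H" shows "bij_betw (\<lambda>x. x \<otimes> h) H H"
  by (rule bij_betwI[of _ _ _ "\<lambda>x. x \<otimes> inv h"])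
    (use assms in \<open>auto simp: subgroup.m_closed subgroup.m_inv_closed subgroup.mem_carrier m_assoc\<close>)

lemma subgroup_bij_left:
  assumes "subgroup H G" "h \<in> H" shows "bij_betw (\<lambda>x. h \<otimes> x) H H"
  by (rule bij_betwI[of _ _ _ "\<lambda>x. inv h \<otimes> x"])
    (use assms in \<open>auto simp: subgroup.m_closed subgroup.m_inv_closed subgroup.mem_carrier m_assoc[symmetric]\<close>)

lemma subgroup_bij_inv:
  assumes "subgroup H G" shows "bij_betw (\<lambda>x. inv x) H H"
  by (rule bij_betwI[of _ _ _ "\<lambda>x. inv x"])
    (use assms in \<open>auto simp: subgroup.m_inv_closed subgroup.mem_carrier\<close>)

lemma rshift_bij:
  assumes "subgroup H G" "h \<in> H" shows "bij_betw (\<lambda>(s, x). (s, x \<otimes> h)) (S \<times> H) (S \<times> H)"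
  using bij_betw_map_prod[OF bij_betw_id subgroup_bij_right[OF assms], of S] by (simp add: map_prod_def)

lemma rshift_l2:
  assumes "subgroup H G" "h \<in> H" "v \<in> l2 (S \<times> H)" shows "rshift G H h v \<in> l2 (S \<times> H)"
proof -
  have "(\<lambda>i. (cmod (rshift G H h v i))\<^sup>2) summable_on S \<times> H \<longleftrightarrow>
    (\<lambda>i. (cmod (v (case i of (s, x) \<Rightarrow> (s, x \<otimes> h))))\<^sup>2) summable_on S \<times> H"
    by (rule summable_on_cong) (auto simp: rshift_def)
  also have "\<dots> \<longleftrightarrow> (\<lambda>i. (cmod (v i))\<^sup>2) summable_on S \<times> H"
    by (rule summable_on_reindex_bij_betw[OF rshift_bij[OF assms(1,2)]])
  finally show ?thesis using assms(3) by (auto simp: l2_def rshift_def)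
qed

lemma rshift_inner:
  assumes "subgroup H G" "h \<in> H"
  shows "l2_inner (S \<times> H) (rshift G H h v) (rshift G H h w) = l2_inner (S \<times> H) v w"
proof -
  let ?f = "\<lambda>(s, x). (s, x \<otimes> h)"
  have "l2_inner (S \<times> H) (rshift G H h v) (rshift G H h w) = (\<Sum>\<^sub>\<infinity>i\<in>S \<times> H. v (?f i) * cnj (w (?f i)))"
    unfolding l2_inner_def by (rule infsum_cong) (auto simp: rshift_def)
  also have "\<dots> = l2_inner (S \<times> H) v w"
    unfolding l2_inner_def by (rule infsum_reindex_bij_betw[OF rshift_bij[OF assms]])
  finally show ?thesis .
qed

lemma rshift_inverse:
  assumes "subgroup H G" "h \<in> H" "v \<in> l2 (S \<times> H)"
  shows "rshift G H h (rshift G H (inv h) v) = v"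
proof (rule ext)
  fix i :: "'a \<times> 'a"
  obtain s x where i: "i = (s, x)" by fastforce
  have "v (s, x) = 0" if "x \<notin> H" using l2_supp[OF assms(3)] that by simp
  moreover have "x \<otimes> h \<in> H" "x \<otimes> h \<otimes> inv h = x" if "x \<in> H"
    using that assms(2) subgroup.m_closed[OF assms(1)] subgroup.mem_carrier[OF assms(1)]
    by (simp_all add: m_assoc)
  ultimately show "rshift G H h (rshift G H (inv h) v) i = v i"
    by (simp add: rshift_def i)
qed

lemma rshift_adjoint:
  assumes "subgroup H G" "h \<in> H" "w \<in> l2 (S \<times> H)"
  shows "l2_inner (S \<times> H) (rshift G H h v) w = l2_inner (S \<times> H) v (rshift G H (inv h) w)"
  using rshift_inner[OF assms(1,2), of S v "rshift G H (inv h) w"] rshift_inverse[OF assms] by simp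

lemma rshift_unit:
  assumes "subgroup H G" "h \<in> H" "k \<in> H"
  shows "rshift G H h (l2_unit (s, k)) = l2_unit (s, k \<otimes> inv h)"
proof -
  have "x \<otimes> h = k \<longleftrightarrow> x = k \<otimes> inv h" if "x \<in> H" for x
    using inv_solve_right[of x k h] that assms(2,3) subgroup.mem_carrier[OF assms(1)] by auto
  moreover have "k \<otimes> inv h \<in> H" using assms by (simp add: subgroup.m_closed subgroup.m_inv_closed)
  ultimately show ?thesis unfolding rshift_def l2_unit_def by (intro ext) (simp split: prod.split; blast)
qed

lemma generating_setD:
  assumes "generating_set G H S"
  shows "finite S" "S \<subseteq> carrier G" "subgroup H G" "S \<subseteq> H"
proof -
  show *: "finite S" "S \<subseteq> carrier G" using assms unfolding generating_set_def by auto
  show "subgroup H G" using assms generate_is_subgroup[OF *(2)] unfolding generating_set_def by simp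
  show "S \<subseteq> H" using assms generate.incl[of _ S G] unfolding generating_set_def by blast
qed

lemma generating_set_generate: "generating_set G H S \<Longrightarrow> generate G S = H"
  by (simp add: generating_set_def)

text \<open>A formal coboundary: the formula is that of \<open>coboundaries_S\<close>, but
  \<open>b\<close> ranges over all functions instead of \<open>l2 H\<close>. In the Cayley graph,
  \<open>v\<close> is the gradient of \<open>b\<close>.\<close>

definition potential :: "'a set \<Rightarrow> 'a set \<Rightarrow> ('a \<Rightarrow> complex) \<Rightarrow> ('a \<times> 'a \<Rightarrow> complex) \<Rightarrow> bool" where
  "potential H S b v \<longleftrightarrow> (\<forall>s\<in>S. \<forall>x\<in>H. v (s, x) = b (inv s \<otimes> x) - b x)"

lemma l2_left_shift:
  assumes H: "subgroup H G" "h \<in> H" and f: "f \<in> l2 H"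
  shows "(\<lambda>x. if x \<in> H then f (h \<otimes> x) else 0) \<in> l2 H"
proof -
  have "(\<lambda>i. (cmod (if i \<in> H then f (h \<otimes> i) else 0))\<^sup>2) summable_on H \<longleftrightarrow>
    (\<lambda>i. (cmod (f (h \<otimes> i)))\<^sup>2) summable_on H"
    by (rule summable_on_cong) auto
  also have "\<dots> \<longleftrightarrow> (\<lambda>i. (cmod (f i))\<^sup>2) summable_on H"
    by (rule summable_on_reindex_bij_betw[OF subgroup_bij_left[OF H]])
  finally show ?thesis using f by (auto simp: l2_def)
qed

text \<open>Differences of \<open>b\<close> obey the cocycle identity, so a word in the generators
  is handled letter by letter, and left translations preserve square summability.\<close>

lemma potential_difference_l2:
  assumes S: "generating_set G H S" and v: "v \<in> l2 (S \<times> H)" and b: "potential H S b v" and g: "g \<in> H"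
  shows "(\<lambda>x. if x \<in> H then b (inv g \<otimes> x) - b x else 0) \<in> l2 H"
proof -
  note SD = generating_setD[OF S]
  note H = SD(3)
  note cl = subgroup.m_closed[OF H] subgroup.m_inv_closed[OF H] subgroup.mem_carrier[OF H] subgroup.one_closed[OF H]
  have gen: "(\<lambda>x. if x \<in> H then b (inv s \<otimes> x) - b x else 0) \<in> l2 H" if s: "s \<in> S" for s
  proof -
    have "(\<lambda>x. if x \<in> H then b (inv s \<otimes> x) - b x else 0) = (\<lambda>x. v (s, x))"
      using s b l2_supp[OF v] by (auto simp: potential_def fun_eq_iff)
    then show ?thesis using l2_slice[OF v s] by simp
  qed
  note gS = generating_set_generate[OF S]
  have "g \<in> generate G S" using g gS by simp
  then show ?thesis
  proof (induction rule: generate.induct)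
    case one
    have "(\<lambda>x. if x \<in> H then b (inv \<one> \<otimes> x) - b x else 0) = (\<lambda>_. 0)"
      by (auto simp: fun_eq_iff cl)
    then show ?case by (simp only: l2_zero)
  next
    case (incl s)
    then show ?case by (rule gen)
  next
    case (inv s)
    then have sH: "s \<in> H" using SD by auto
    have "(\<lambda>x. - (if x \<in> H then (\<lambda>x. if x \<in> H then b (inv s \<otimes> x) - b x else 0) (s \<otimes> x) else 0)) \<in> l2 H"
      by (rule l2_uminus, rule l2_left_shift[OF H sH], rule gen[OF inv])
    moreover have "(\<lambda>x. - (if x \<in> H then (\<lambda>x. if x \<in> H then b (inv s \<otimes> x) - b x else 0) (s \<otimes> x) else 0))
      = (\<lambda>x. if x \<in> H then b (inv (inv s) \<otimes> x) - b x else 0)"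
      using sH by (auto simp: fun_eq_iff cl m_assoc[symmetric])
    ultimately show ?case by simp
  next
    case (eng g h)
    then have gh: "g \<in> H" "h \<in> H" using gS by auto
    have "(\<lambda>x. (if x \<in> H then b (inv g \<otimes> x) - b x else 0) +
      (if x \<in> H then (\<lambda>x. if x \<in> H then b (inv h \<otimes> x) - b x else 0) (inv g \<otimes> x) else 0)) \<in> l2 H"
      by (intro l2_add eng.IH l2_left_shift[OF H]) (use gh cl in auto)
    moreover have "(\<lambda>x. (if x \<in> H then b (inv g \<otimes> x) - b x else 0) +
      (if x \<in> H then (\<lambda>x. if x \<in> H then b (inv h \<otimes> x) - b x else 0) (inv g \<otimes> x) else 0))
      = (\<lambda>x. if x \<in> H then b (inv (g \<otimes> h) \<otimes> x) - b x else 0)"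
      using gh by (auto simp: fun_eq_iff cl m_assoc inv_mult_group)
    ultimately show ?case by simp
  qed
qed

text \<open>Every cocycle is a formal coboundary, and conversely the differences of a potential
  extend \<open>v\<close> to a cocycle on all of \<open>H\<close>. From here on cocycles are handled
  through their potentials.\<close>

lemma cocycles_S_iff:
  assumes S: "generating_set G H S"
  shows "v \<in> cocycles_S G H S \<longleftrightarrow> v \<in> l2 (S \<times> H) \<and> (\<exists>b. potential H S b v)"
proof -
  note SD = generating_setD[OF S]
  note H = SD(3)
  note cl = subgroup.m_closed[OF H] subgroup.m_inv_closed[OF H] subgroup.mem_carrier[OF H] subgroup.one_closed[OF H]
  show ?thesis
  proof (intro iffI conjI)
    assume "v \<in> cocycles_S G H S"
    then obtain c where c: "\<And>g. g \<in> H \<Longrightarrow> c g \<in> l2 H"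
      "\<And>g h x. g \<in> H \<Longrightarrow> h \<in> H \<Longrightarrow> x \<in> H \<Longrightarrow> c (g \<otimes> h) x = c g x + c h (inv g \<otimes> x)"
      "\<And>s x. v (s, x) = (if s \<in> S then c s x else 0)"
      unfolding cocycles_S_def by blast
    show "v \<in> l2 (S \<times> H)"
      by (rule l2_TimesI) (use SD c in auto)
    \<comment> \<open>The cocycle identity for \<open>inv x \<otimes> s\<close>, evaluated at
      \<open>\<one>\<close>, writes \<open>c s x\<close> as a difference of values at
      \<open>\<one>\<close>; this dictates the potential.\<close>
    have "potential H S (\<lambda>y. c (inv y) \<one>) v"
      unfolding potential_def
    proof (intro ballI)
      fix s x assume s: "s \<in> S" and x: "x \<in> H"
      have sH: "s \<in> H" using s SD by auto
      have "c (inv x \<otimes> s) \<one> = c (inv x) \<one> + c s x"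
        using c(2)[of "inv x" s \<one>] sH x by (simp add: cl)
      then show "v (s, x) = c (inv (inv s \<otimes> x)) \<one> - c (inv x) \<one>"
        using s sH x by (simp add: c(3) cl inv_mult_group)
    qed
    then show "\<exists>b. potential H S b v" by blast
  next
    assume *: "v \<in> l2 (S \<times> H) \<and> (\<exists>b. potential H S b v)"
    then obtain b where v: "v \<in> l2 (S \<times> H)" and b: "potential H S b v" by auto
    let ?c = "\<lambda>g x. if x \<in> H then b (inv g \<otimes> x) - b x else 0"
    have "\<forall>g\<in>H. ?c g \<in> l2 H" using potential_difference_l2[OF S v b] by blast
    moreover have "\<forall>g\<in>H. \<forall>h\<in>H. \<forall>x\<in>H. ?c (g \<otimes> h) x = ?c g x + ?c h (inv g \<otimes> x)"
      by (auto simp: cl inv_mult_group m_assoc)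
    moreover have "\<forall>s x. v (s, x) = (if s \<in> S then ?c s x else 0)"
      using b l2_supp[OF v] by (auto simp: potential_def)
    ultimately show "v \<in> cocycles_S G H S"
      unfolding cocycles_S_def by (intro CollectI exI[of _ ?c] conjI)
  qed
qed

lemma rshift_potential:
  assumes "subgroup H G" "S \<subseteq> H" "h \<in> H" "potential H S b v"
  shows "potential H S (\<lambda>x. b (x \<otimes> h)) (rshift G H h v)"
  unfolding potential_def
proof (intro ballI)
  note H = assms(1)
  fix s x assume s: "s \<in> S" and x: "x \<in> H"
  have c: "s \<in> carrier G" "x \<in> carrier G" "h \<in> carrier G" "x \<otimes> h \<in> H"
    using s x assms(2,3) subgroup.mem_carrier[OF H] subgroup.m_closed[OF H] by auto
  have "rshift G H h v (s, x) = v (s, x \<otimes> h)" using x by (simp add: rshift_def)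
  also have "\<dots> = b (inv s \<otimes> (x \<otimes> h)) - b (x \<otimes> h)"
    using assms(4) s c(4) unfolding potential_def by blast
  finally show "rshift G H h v (s, x) = b (inv s \<otimes> x \<otimes> h) - b (x \<otimes> h)"
    using c by (simp add: m_assoc)
qed

lemma rshift_cocycles:
  assumes S: "generating_set G H S" and h: "h \<in> H" and v: "v \<in> cocycles_S G H S"
  shows "rshift G H h v \<in> cocycles_S G H S"
proof -
  from v obtain b where "v \<in> l2 (S \<times> H)" "potential H S b v" unfolding cocycles_S_iff[OF S] by auto
  with rshift_l2[OF generating_setD(3)[OF S] h] rshift_potential[OF generating_setD(3,4)[OF S] h]
  show ?thesis unfolding cocycles_S_iff[OF S] by metis
qed

text \<open>The difference is a signed sum of values of \<open>v\<close> along a path from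
  \<open>\<one>\<close> to \<open>inv u\<close>, hence a bounded functional represented by one
  vector for all \<open>v\<close>. A generator \<open>s\<close> contributes the edge
  \<open>(s, \<one>)\<close>, its inverse the edge \<open>(s, s)\<close> traversed
  backwards.\<close>

lemma potential_kernel:
  assumes S: "generating_set G H S" and u: "u \<in> H"
  shows "\<exists>\<kappa>\<in>l2 (S \<times> H). \<forall>v\<in>l2 (S \<times> H). \<forall>b. potential H S b v \<longrightarrow>
    b (inv u) - b \<one> = l2_inner (S \<times> H) v \<kappa>"
proof -
  note SD = generating_setD[OF S]
  note H = SD(3)
  note cl = subgroup.m_closed[OF H] subgroup.m_inv_closed[OF H] subgroup.mem_carrier[OF H] subgroup.one_closed[OF H]
  note gS = generating_set_generate[OF S]
  have "u \<in> generate G S" using u gS by simp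
  then show ?thesis
  proof (induction rule: generate.induct)
    case one
    show ?case by (rule bexI[OF _ l2_zero]) (simp add: l2_inner_zero_right)
  next
    case (incl s)
    then have s: "(s, \<one>) \<in> S \<times> H" "s \<in> H" using SD cl by auto
    show ?case
      by (rule bexI[OF _ l2_unit[OF s(1)]]) (use s in \<open>auto simp: l2_inner_unit potential_def cl\<close>)
  next
    case (inv s)
    then have s: "(s, s) \<in> S \<times> H" "s \<in> H" using SD cl by auto
    show ?case
      by (rule bexI[OF _ l2_uminus[OF l2_unit[OF s(1)]]])
        (use s in \<open>auto simp: l2_inner_unit l2_inner_uminus_right potential_def cl\<close>)
  next
    case (eng g h)
    then have gh: "g \<in> H" "h \<in> H" using gS by auto
    from eng.IH obtain k l where k: "k \<in> l2 (S \<times> H)"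
      "\<And>v b. v \<in> l2 (S \<times> H) \<Longrightarrow> potential H S b v \<Longrightarrow> b (inv g) - b \<one> = l2_inner (S \<times> H) v k"
      and l: "l \<in> l2 (S \<times> H)"
      "\<And>v b. v \<in> l2 (S \<times> H) \<Longrightarrow> potential H S b v \<Longrightarrow> b (inv h) - b \<one> = l2_inner (S \<times> H) v l"
      by blast
    \<comment> \<open>The path for \<open>h\<close> has to start at \<open>inv g\<close>, so its
      kernel is translated.\<close>
    let ?l = "rshift G H g l"
    have ll: "?l \<in> l2 (S \<times> H)" using rshift_l2[OF H gh(1) l(1)] .
    have "b (inv (g \<otimes> h)) - b \<one> = l2_inner (S \<times> H) v (\<lambda>i. k i + ?l i)"
      if v: "v \<in> l2 (S \<times> H)" and b: "potential H S b v" for v b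
    proof -
      have ig: "inv g \<in> H" using gh cl by auto
      have "b (inv h \<otimes> inv g) - b (\<one> \<otimes> inv g) = l2_inner (S \<times> H) (rshift G H (inv g) v) l"
        by (rule l(2)[OF rshift_l2[OF H ig v] rshift_potential[OF H SD(4) ig b]])
      also have "\<dots> = l2_inner (S \<times> H) v ?l"
        using rshift_adjoint[OF H ig l(1)] gh by (simp add: cl)
      finally show ?thesis
        using k(2)[OF v b] gh by (simp add: l2_inner_add_right[OF k(1) ll v] inv_mult_group cl algebra_simps)
    qed
    then show ?case using l2_add[OF k(1) ll] by blast
  qed
qed

text \<open>A potential can be rebuilt from \<open>v\<close> by inner products with kernels. Being a
  cocycle thus means that \<open>v\<close> is the gradient of this potential, a family of
  orthogonality conditions.\<close>

lemma cocycles_S_closed_subspace: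
  assumes S: "generating_set G H S"
  shows "l2_closed_subspace (S \<times> H) (cocycles_S G H S)"
proof -
  note SD = generating_setD[OF S]
  note H = SD(3)
  note cl = subgroup.m_closed[OF H] subgroup.m_inv_closed[OF H] subgroup.mem_carrier[OF H] subgroup.one_closed[OF H]
  let ?I = "S \<times> H"
  have "\<forall>u\<in>H. \<exists>k. k \<in> l2 ?I \<and>
    (\<forall>v\<in>l2 ?I. \<forall>b. potential H S b v \<longrightarrow> b (inv u) - b \<one> = l2_inner ?I v k)"
    using potential_kernel[OF S] unfolding Bex_def by (intro ballI)
  from bchoice[OF this] obtain \<kappa> where \<kappa>0: "\<forall>u\<in>H. \<kappa> u \<in> l2 ?I \<and>
    (\<forall>v\<in>l2 ?I. \<forall>b. potential H S b v \<longrightarrow> b (inv u) - b \<one> = l2_inner ?I v (\<kappa> u))" ..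
  have \<kappa>: "\<And>u. u \<in> H \<Longrightarrow> \<kappa> u \<in> l2 ?I"
    "\<And>u v b. u \<in> H \<Longrightarrow> v \<in> l2 ?I \<Longrightarrow> potential H S b v \<Longrightarrow> b (inv u) - b \<one> = l2_inner ?I v (\<kappa> u)"
    using \<kappa>0 by simp_all
  \<comment> \<open>Orthogonality to \<open>m (s, x)\<close> says that \<open>v (s, x)\<close> is
    the difference of the rebuilt potential along that edge.\<close>
  define m where "m = (\<lambda>(s, x). (\<lambda>i. (\<kappa> (inv x \<otimes> s) i - \<kappa> (inv x) i) - l2_unit (s, x) i))"
  have ml: "m (s, x) \<in> l2 ?I" if "s \<in> S" "x \<in> H" for s x
    unfolding m_def using that SD by (auto intro!: l2_diff \<kappa>(1) l2_unit simp: cl subset_iff)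
  have inner: "l2_inner ?I v (m (s, x)) = l2_inner ?I v (\<kappa> (inv x \<otimes> s)) - l2_inner ?I v (\<kappa> (inv x)) - v (s, x)"
    if "s \<in> S" "x \<in> H" and v: "v \<in> l2 ?I" for v s x
  proof -
    have "\<kappa> (inv x \<otimes> s) \<in> l2 ?I" "\<kappa> (inv x) \<in> l2 ?I" "l2_unit (s, x) \<in> l2 ?I"
      using that SD by (auto intro!: \<kappa>(1) l2_unit simp: cl subset_iff)
    then show ?thesis unfolding m_def using v that by (simp add: l2_inner_diff_right l2_diff l2_inner_unit)
  qed
  have "cocycles_S G H S = {v \<in> l2 ?I. \<forall>k\<in>m ` ?I. l2_inner ?I v k = 0}"
  proof (intro subset_antisym subsetI)
    fix v assume "v \<in> cocycles_S G H S"
    then obtain b where v: "v \<in> l2 ?I" and b: "potential H S b v" by (auto simp: cocycles_S_iff[OF S])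
    have "l2_inner ?I v (m (s, x)) = 0" if sx: "s \<in> S" "x \<in> H" for s x
    proof -
      have sH: "s \<in> H" using sx SD by auto
      have "l2_inner ?I v (\<kappa> (inv x \<otimes> s)) = b (inv s \<otimes> x) - b \<one>"
        using \<kappa>(2)[OF _ v b, of "inv x \<otimes> s"] sH sx by (simp add: cl inv_mult_group)
      moreover have "l2_inner ?I v (\<kappa> (inv x)) = b x - b \<one>"
        using \<kappa>(2)[OF _ v b, of "inv x"] sH sx by (simp add: cl)
      ultimately show ?thesis using inner[OF sx v] b sx by (simp add: potential_def)
    qed
    with v show "v \<in> {v \<in> l2 ?I. \<forall>k\<in>m ` ?I. l2_inner ?I v k = 0}" by auto
  next
    fix v assume "v \<in> {v \<in> l2 ?I. \<forall>k\<in>m ` ?I. l2_inner ?I v k = 0}"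
    then have v: "v \<in> l2 ?I" and z: "\<And>s x. s \<in> S \<Longrightarrow> x \<in> H \<Longrightarrow> l2_inner ?I v (m (s, x)) = 0" by auto
    have "potential H S (\<lambda>y. l2_inner ?I v (\<kappa> (inv y))) v"
      unfolding potential_def
    proof (intro ballI)
      fix s x assume sx: "s \<in> S" "x \<in> H"
      then have "s \<in> H" using SD by auto
      then show "v (s, x) = l2_inner ?I v (\<kappa> (inv (inv s \<otimes> x))) - l2_inner ?I v (\<kappa> (inv x))"
        using inner[OF sx v] z[OF sx] sx by (simp add: inv_mult_group cl)
    qed
    with v show "v \<in> cocycles_S G H S" by (auto simp: cocycles_S_iff[OF S])
  qed
  moreover have "l2_closed_subspace ?I {v \<in> l2 ?I. \<forall>k\<in>m ` ?I. l2_inner ?I v k = 0}"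
    by (rule l2_closed_subspace_annihilator) (use ml in auto)
  ultimately show ?thesis by simp
qed

text \<open>The shift is unitary and it and its inverse preserve the cocycle space, so it commutes
  with the projection.\<close>

lemma l2_proj_rshift:
  assumes S: "generating_set G H S" and h: "h \<in> H" and x: "x \<in> l2 (S \<times> H)"
  shows "l2_proj (S \<times> H) (cocycles_S G H S) (rshift G H h x) =
    rshift G H h (l2_proj (S \<times> H) (cocycles_S G H S) x)"
proof -
  let ?I = "S \<times> H" and ?Z = "cocycles_S G H S"
  note H = generating_setD(3)[OF S]
  note Z = cocycles_S_closed_subspace[OF S]
  let ?p = "l2_proj ?I ?Z x"
  have p: "?p \<in> ?Z" using l2_proj_in[OF Z x] .
  show ?thesis
  proof (rule l2_proj_unique[OF Z rshift_l2[OF H h x] rshift_cocycles[OF S h p]])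
    fix v assume v: "v \<in> ?Z"
    have ih: "inv h \<in> H" using subgroup.m_inv_closed[OF H h] .
    have "rshift G H h x - rshift G H h ?p = rshift G H h (x - ?p)" by (auto simp: rshift_def fun_eq_iff)
    then have "l2_inner ?I (rshift G H h x - rshift G H h ?p) v = l2_inner ?I (x - ?p) (rshift G H (inv h) v)"
      using rshift_adjoint[OF H h l2_closed_subspace_l2[OF Z v]] by simp
    also have "\<dots> = 0" by (rule l2_proj_orth[OF Z x rshift_cocycles[OF S ih v]])
    finally show "l2_inner ?I (rshift G H h x - rshift G H h ?p) v = 0" .
  qed
qed

end

section \<open>Independence of the generating set\<close>

definition restr :: "'g set \<Rightarrow> ('g \<times> 'g \<Rightarrow> complex) \<Rightarrow> 'g \<times> 'g \<Rightarrow> complex" where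
  "restr S w = (\<lambda>(s, x). if s \<in> S then w (s, x) else 0)"

text \<open>The quantity \<open>f s\<close> of the overview: the share of the generator
  \<open>s\<close> in the von Neumann dimension of the cocycles.\<close>

definition cocycle_density :: "('g, 'b) monoid_scheme \<Rightarrow> 'g set \<Rightarrow> 'g set \<Rightarrow> 'g \<Rightarrow> real" where
  "cocycle_density G H S s =
    Re (l2_proj (S \<times> H) (cocycles_S G H S) (l2_unit (s, \<one>\<^bsub>G\<^esub>)) (s, \<one>\<^bsub>G\<^esub>))"

lemma vN_dim_cocycles: "vN_dim_S G H S (cocycles_S G H S) = (\<Sum>s\<in>S. cocycle_density G H S s)"
  by (simp add: vN_dim_S_def cocycle_density_def l2_unit_def)

context group
begin

lemma restr_cocycles:
  assumes S: "generating_set G H S" and U: "generating_set G H U" and SU: "S \<subseteq> U"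
    and w: "w \<in> cocycles_S G H U"
  shows "restr S w \<in> cocycles_S G H S"
proof -
  from w obtain b where b: "potential H U b w" and wl: "w \<in> l2 (U \<times> H)"
    by (auto simp: cocycles_S_iff[OF U])
  have "restr S w \<in> l2 (S \<times> H)"
    by (rule l2_TimesI) (use SU generating_setD(1)[OF S] l2_slice[OF wl] in \<open>auto simp: restr_def\<close>)
  moreover have "potential H S b (restr S w)" using b SU by (auto simp: potential_def restr_def)
  ultimately show ?thesis by (auto simp: cocycles_S_iff[OF S])
qed

text \<open>The potential of \<open>v\<close> also prescribes the values at the remaining elements
  of \<open>U\<close>, and these are square summable by
  \<open>potential_difference_l2\<close>.\<close>

lemma extend_cocycles:
  assumes S: "generating_set G H S" and U: "generating_set G H U" and SU: "S \<subseteq> U"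
    and v: "v \<in> cocycles_S G H S"
  shows "\<exists>w\<in>cocycles_S G H U. restr S w = v"
proof -
  from v obtain b where b: "potential H S b v" and vl: "v \<in> l2 (S \<times> H)"
    by (auto simp: cocycles_S_iff[OF S])
  define w where "w = (\<lambda>(s, x). if s \<in> U then if x \<in> H then b (inv s \<otimes> x) - b x else 0 else 0)"
  have "w \<in> l2 (U \<times> H)"
    by (rule l2_TimesI)
      (use generating_setD[OF U] potential_difference_l2[OF S vl b] in \<open>auto simp: w_def\<close>)
  moreover have "potential H U b w" by (auto simp: potential_def w_def)
  ultimately have "w \<in> cocycles_S G H U" by (auto simp: cocycles_S_iff[OF U])
  moreover have "restr S w = v"
    using b SU l2_supp[OF vl] by (auto simp: potential_def restr_def w_def fun_eq_iff)
  ultimately show ?thesis by blast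
qed

text \<open>The value \<open>w (u, \<one>)\<close> is a difference of a potential shared by
  \<open>w\<close> and its restriction, so \<open>potential_kernel\<close> applies. Projecting the
  kernel makes \<open>a\<close> a cocycle without changing inner products with cocycles.\<close>

lemma cocycles_evaluation:
  assumes S: "generating_set G H S" and U: "generating_set G H U" and SU: "S \<subseteq> U" and u: "u \<in> U"
  shows "\<exists>a\<in>cocycles_S G H S. \<forall>w\<in>cocycles_S G H U. w (u, \<one>) = l2_inner (S \<times> H) (restr S w) a"
proof -
  note H = generating_setD(3)[OF S]
  have uH: "u \<in> H" using u generating_setD(4)[OF U] by auto
  note Z = cocycles_S_closed_subspace[OF S]
  obtain k where k: "k \<in> l2 (S \<times> H)"
    "\<And>v b. v \<in> l2 (S \<times> H) \<Longrightarrow> potential H S b v \<Longrightarrow> b (inv u) - b \<one> = l2_inner (S \<times> H) v k"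
    using potential_kernel[OF S uH] by blast
  show ?thesis
  proof (intro bexI ballI)
    fix w assume w: "w \<in> cocycles_S G H U"
    then obtain b where b: "potential H U b w" by (auto simp: cocycles_S_iff[OF U])
    have r: "restr S w \<in> cocycles_S G H S" by (rule restr_cocycles[OF S U SU w])
    have "potential H S b (restr S w)" using b SU by (auto simp: potential_def restr_def)
    then have "l2_inner (S \<times> H) (restr S w) k = b (inv u) - b \<one>"
      using k(2)[OF l2_closed_subspace_l2[OF Z r]] by simp
    also have "\<dots> = w (u, \<one>)"
      using b u subgroup.one_closed[OF H] subgroup.mem_carrier[OF H uH] by (simp add: potential_def)
    finally show "w (u, \<one>) = l2_inner (S \<times> H) (restr S w) (l2_proj (S \<times> H) (cocycles_S G H S) k)"
      using l2_inner_proj_right[OF Z k(1) r] by simp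
  qed (rule l2_proj_in[OF Z k(1)])
qed

text \<open>Unit vectors with the same generator are right translates of each other, so the
  projection is determined by its columns at \<open>\<one>\<close>.\<close>

lemma l2_proj_cocycles_unit_shift:
  assumes S: "generating_set G H S" and h: "h \<in> H" and s: "s \<in> S"
  shows "l2_proj (S \<times> H) (cocycles_S G H S) (l2_unit (s, h)) =
    rshift G H (inv h) (l2_proj (S \<times> H) (cocycles_S G H S) (l2_unit (s, \<one>)))"
proof -
  note H = generating_setD(3)[OF S]
  have ih: "inv h \<in> H" "\<one> \<in> H" using h subgroup.m_inv_closed[OF H] subgroup.one_closed[OF H] by auto
  have "l2_unit (s, h) = rshift G H (inv h) (l2_unit (s, \<one>))"
    using rshift_unit[OF H ih] subgroup.mem_carrier[OF H h] by simp
  then show ?thesis using l2_proj_rshift[OF S ih(1) l2_unit] s ih by simp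
qed

text \<open>Restriction and extension of cocycles are mutually inverse bounded equivariant maps \<open>J\<close> and
  \<open>L\<close>, so the two dimensions are the traces of \<open>L J\<close> and \<open>J L\<close>; both are expanded into the same
  sum of matrix entries.\<close>

lemma vN_dim_cocycles_mono_eq:
  assumes S: "generating_set G H S" and U: "generating_set G H U" and SU: "S \<subseteq> U"
  shows "vN_dim_S G H S (cocycles_S G H S) = vN_dim_S G H U (cocycles_S G H U)"
proof -
  note H = generating_setD(3)[OF S]
  note cl = subgroup.m_closed[OF H] subgroup.m_inv_closed[OF H] subgroup.mem_carrier[OF H] subgroup.one_closed[OF H]
  note Z = cocycles_S_closed_subspace[OF S] and ZU = cocycles_S_closed_subspace[OF U]
  define p where "p s = l2_proj (S \<times> H) (cocycles_S G H S) (l2_unit (s, \<one>))" for s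
  define q where "q u = l2_proj (U \<times> H) (cocycles_S G H U) (l2_unit (u, \<one>))" for u
  have "\<forall>u\<in>U. \<exists>a. a \<in> cocycles_S G H S \<and>
    (\<forall>w\<in>cocycles_S G H U. w (u, \<one>) = l2_inner (S \<times> H) (restr S w) a)"
    using cocycles_evaluation[OF S U SU] unfolding Bex_def by (intro ballI)
  from bchoice[OF this] obtain a where a0: "\<forall>u\<in>U. a u \<in> cocycles_S G H S \<and>
    (\<forall>w\<in>cocycles_S G H U. w (u, \<one>) = l2_inner (S \<times> H) (restr S w) (a u))" ..
  have a: "a u \<in> cocycles_S G H S" if "u \<in> U" for u using a0 that by simp
  have ev: "w (u, \<one>) = l2_inner (S \<times> H) (restr S w) (a u)" if "u \<in> U" "w \<in> cocycles_S G H U" for u w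
    using a0 that by simp
  have q: "q u \<in> cocycles_S G H U" if "u \<in> U" for u
    unfolding q_def using that cl by (intro l2_proj_in[OF ZU] l2_unit) auto
  have p: "p s \<in> cocycles_S G H S" if "s \<in> S" for s
    unfolding p_def using that cl by (intro l2_proj_in[OF Z] l2_unit) auto
  \<comment> \<open>The common matrix entry: summed over \<open>s\<close> it gives a diagonal entry
    for \<open>U\<close>, summed over \<open>u\<close> one for \<open>S\<close>.\<close>
  let ?t = "\<lambda>u s. l2_inner H (\<lambda>x. q u (s, x)) (\<lambda>x. a u (s, x))"
  have A: "q u (u, \<one>) = (\<Sum>s\<in>S. ?t u s)" if u: "u \<in> U" for u
  proof -
    have "q u (u, \<one>) = l2_inner (S \<times> H) (restr S (q u)) (a u)" by (rule ev[OF u q[OF u]])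
    also have "\<dots> = (\<Sum>s\<in>S. l2_inner H (\<lambda>x. restr S (q u) (s, x)) (\<lambda>x. a u (s, x)))"
      by (rule l2_inner_Times[OF generating_setD(1)[OF S]])
        (use l2_closed_subspace_l2[OF Z] restr_cocycles[OF S U SU q[OF u]] a[OF u] in auto)
    also have "\<dots> = (\<Sum>s\<in>S. ?t u s)" by (rule sum.cong) (auto simp: restr_def)
    finally show ?thesis .
  qed
  have B: "p s (s, \<one>) = (\<Sum>u\<in>U. ?t u s)" if s: "s \<in> S" for s
  proof -
    have sU: "s \<in> U" using s SU by auto
    obtain w where w: "w \<in> cocycles_S G H U" "restr S w = p s"
      using extend_cocycles[OF S U SU p[OF s]] by blast
    \<comment> \<open>Translating \<open>w\<close> moves the argument \<open>h\<close> to
      \<open>\<one>\<close>, where \<open>ev\<close> applies; since \<open>w\<close> restricts to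
      the projected unit vector \<open>p s\<close>, only one coordinate of \<open>a u\<close>
      survives.\<close>
    have wv: "w (u, h) = cnj (a u (s, inv h))" if u: "u \<in> U" and h: "h \<in> H" for u h
    proof -
      have ih: "inv h \<in> H" using h cl by auto
      have ra: "rshift G H (inv h) (a u) \<in> cocycles_S G H S" by (rule rshift_cocycles[OF S ih a[OF u]])
      have "w (u, h) = rshift G H h w (u, \<one>)" using h by (simp add: rshift_def cl)
      also have "\<dots> = l2_inner (S \<times> H) (restr S (rshift G H h w)) (a u)"
        by (rule ev[OF u rshift_cocycles[OF U h w(1)]])
      also have "restr S (rshift G H h w) = rshift G H h (p s)"
        unfolding w(2)[symmetric] by (auto simp: restr_def rshift_def fun_eq_iff)
      also have "l2_inner (S \<times> H) (rshift G H h (p s)) (a u) = l2_inner (S \<times> H) (p s) (rshift G H (inv h) (a u))"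
        by (rule rshift_adjoint[OF H h l2_closed_subspace_l2[OF Z a[OF u]]])
      also have "\<dots> = l2_inner (S \<times> H) (l2_unit (s, \<one>)) (rshift G H (inv h) (a u))"
        unfolding p_def by (rule l2_inner_proj_left[OF Z l2_unit ra]) (use s cl in auto)
      also have "\<dots> = cnj (rshift G H (inv h) (a u) (s, \<one>))"
        using s by (subst l2_inner_cnj) (simp add: l2_inner_unit cl)
      finally show ?thesis using ih by (simp add: rshift_def cl)
    qed
    \<comment> \<open>Hermitian symmetry of the projection combined with right invariance.\<close>
    have qv: "q s (u, h) = cnj (q u (s, inv h))" if u: "u \<in> U" and h: "h \<in> H" for u h
    proof -
      have ih: "inv h \<in> H" using h cl by auto
      have uh: "(u, h) \<in> U \<times> H" and s1: "(s, \<one>) \<in> U \<times> H" using u h sU cl by auto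
      let ?q = "l2_proj (U \<times> H) (cocycles_S G H U) (l2_unit (u, h))"
      have qh: "?q \<in> cocycles_S G H U" by (rule l2_proj_in[OF ZU l2_unit[OF uh]])
      have "q s (u, h) = l2_inner (U \<times> H) (q s) (l2_unit (u, h))" by (simp add: l2_inner_unit[OF uh])
      also have "\<dots> = l2_inner (U \<times> H) (q s) ?q"
        using l2_inner_proj_right[OF ZU l2_unit[OF uh] q[OF sU]] by simp
      also have "\<dots> = l2_inner (U \<times> H) (l2_unit (s, \<one>)) ?q"
        unfolding q_def by (rule l2_inner_proj_left[OF ZU l2_unit[OF s1] qh])
      also have "\<dots> = cnj (?q (s, \<one>))"
        by (subst l2_inner_cnj) (simp add: l2_inner_unit[OF s1])
      also have "?q (s, \<one>) = q u (s, inv h)"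
        unfolding l2_proj_cocycles_unit_shift[OF U h u] q_def[symmetric] using ih by (simp add: rshift_def cl)
      finally show ?thesis .
    qed
    have s1: "(s, \<one>) \<in> U \<times> H" using sU cl by auto
    have "p s (s, \<one>) = w (s, \<one>)" unfolding w(2)[symmetric] using s by (simp add: restr_def)
    also have "\<dots> = l2_inner (U \<times> H) w (l2_unit (s, \<one>))" by (simp add: l2_inner_unit[OF s1])
    also have "\<dots> = l2_inner (U \<times> H) w (q s)"
      unfolding q_def by (rule l2_inner_proj_right[OF ZU l2_unit[OF s1] w(1), symmetric])
    also have "\<dots> = (\<Sum>u\<in>U. l2_inner H (\<lambda>h. w (u, h)) (\<lambda>h. q s (u, h)))"
      by (rule l2_inner_Times[OF generating_setD(1)[OF U]])
        (use l2_closed_subspace_l2[OF ZU] w q[OF sU] in auto)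
    also have "\<dots> = (\<Sum>u\<in>U. ?t u s)"
    proof (rule sum.cong[OF refl])
      fix u assume u: "u \<in> U"
      \<comment> \<open>Conjugating twice frees the \<open>q\<close> factor; substituting
        \<open>inv h\<close> for \<open>h\<close> then produces \<open>?t u s\<close>.\<close>
      have "l2_inner H (\<lambda>h. w (u, h)) (\<lambda>h. q s (u, h)) =
        (\<Sum>\<^sub>\<infinity>h\<in>H. q u (s, inv h) * cnj (a u (s, inv h)))"
        unfolding l2_inner_def by (rule infsum_cong) (simp add: wv[OF u] qv[OF u])
      also have "\<dots> = ?t u s"
        unfolding l2_inner_def
        by (rule infsum_reindex_bij_betw[OF subgroup_bij_inv[OF H], of "\<lambda>h. q u (s, h) * cnj (a u (s, h))"])
      finally show "l2_inner H (\<lambda>h. w (u, h)) (\<lambda>h. q s (u, h)) = ?t u s" .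
    qed
    finally show ?thesis .
  qed
  have "(\<Sum>s\<in>S. p s (s, \<one>)) = (\<Sum>s\<in>S. \<Sum>u\<in>U. ?t u s)" by (rule sum.cong) (simp_all add: B)
  also have "\<dots> = (\<Sum>u\<in>U. \<Sum>s\<in>S. ?t u s)" by (rule sum.swap)
  also have "\<dots> = (\<Sum>u\<in>U. q u (u, \<one>))" by (rule sum.cong) (simp_all add: A)
  finally have "Re (\<Sum>s\<in>S. p s (s, \<one>)) = Re (\<Sum>u\<in>U. q u (u, \<one>))" by simp
  then show ?thesis by (simp add: vN_dim_cocycles cocycle_density_def p_def q_def)
qed

text \<open>Both generating sets are compared with their union.\<close>

lemma vN_dim_cocycles_eq:
  assumes S: "generating_set G H S" and T: "generating_set G H T"
  shows "vN_dim_S G H S (cocycles_S G H S) = vN_dim_S G H T (cocycles_S G H T)"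
proof -
  have "generate G (S \<union> T) = H"
  proof
    show "H \<subseteq> generate G (S \<union> T)"
      using mono_generate[of S "S \<union> T"] generating_set_generate[OF S] by simp
    show "generate G (S \<union> T) \<subseteq> H"
      by (rule generate_subgroup_incl) (use generating_setD[OF S] generating_setD[OF T] in auto)
  qed
  then have "generating_set G H (S \<union> T)"
    using generating_setD[OF S] generating_setD[OF T] by (simp add: generating_set_def)
  then show ?thesis using vN_dim_cocycles_mono_eq[OF S] vN_dim_cocycles_mono_eq[OF T] by simp
qed

section \<open>Bounding the first L2-Betti number by densities\<close>

lemma cocycle_density_bounds:
  assumes S: "generating_set G H S" and s: "s \<in> S"
  shows "0 \<le> cocycle_density G H S s" "cocycle_density G H S s \<le> 1"
  unfolding cocycle_density_def
  using l2_proj_unit_diag_bounds[OF cocycles_S_closed_subspace[OF S], of "(s, \<one>)"] s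
    subgroup.one_closed[OF generating_setD(3)[OF S]] by auto

text \<open>The dimension of the closed coboundaries is nonnegative, as a sum of diagonal entries of
  a projection, and is dropped.\<close>

lemma L2_betti1_S_le:
  assumes S: "generating_set G H S"
  shows "L2_betti1_S G H S \<le> (\<Sum>s\<in>S. cocycle_density G H S s)"
proof -
  note SD = generating_setD[OF S]
  note H = SD(3)
  note cl = subgroup.m_closed[OF H] subgroup.m_inv_closed[OF H] subgroup.mem_carrier[OF H] subgroup.one_closed[OF H]
  let ?B = "coboundaries_S G H S"
  have "l2_closed_subspace (S \<times> H) (l2_closure (S \<times> H) ?B)"
  proof (rule l2_closed_subspace_closure)
    show "?B \<subseteq> l2 (S \<times> H)"
    proof
      fix v assume "v \<in> ?B"
      then obtain f where f: "f \<in> l2 H"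
        and v: "\<And>s x. v (s, x) = (if s \<in> S \<and> x \<in> H then f (inv s \<otimes> x) - f x else 0)"
        unfolding coboundaries_S_def by blast
      show "v \<in> l2 (S \<times> H)"
      proof (rule l2_TimesI[OF SD(1)])
        fix s assume s: "s \<in> S"
        then have sH: "inv s \<in> H" using SD cl by auto
        have "(\<lambda>x. v (s, x)) = (\<lambda>x. (if x \<in> H then f (inv s \<otimes> x) else 0) - f x)"
          using s l2_supp[OF f] by (auto simp: v fun_eq_iff)
        then show "(\<lambda>x. v (s, x)) \<in> l2 H" using l2_diff[OF l2_left_shift[OF H sH f] f] by simp
      qed (simp add: v)
    qed
    show "(\<lambda>_. 0) \<in> ?B"
      unfolding coboundaries_S_def using l2_zero[of H] by (intro CollectI bexI[of _ "\<lambda>_. 0"]) auto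
  next
    fix v w assume "v \<in> ?B" "w \<in> ?B"
    then obtain f g where fg: "f \<in> l2 H" "g \<in> l2 H"
      and v: "\<And>s x. v (s, x) = (if s \<in> S \<and> x \<in> H then f (inv s \<otimes> x) - f x else 0)"
      and w: "\<And>s x. w (s, x) = (if s \<in> S \<and> x \<in> H then g (inv s \<otimes> x) - g x else 0)"
      unfolding coboundaries_S_def by blast
    show "(\<lambda>i. v i + w i) \<in> ?B"
      unfolding coboundaries_S_def using l2_add[OF fg]
      by (intro CollectI bexI[of _ "\<lambda>x. f x + g x"]) (simp_all add: v w)
  next
    fix c v assume "v \<in> ?B"
    then obtain f where f: "f \<in> l2 H"
      and v: "\<And>s x. v (s, x) = (if s \<in> S \<and> x \<in> H then f (inv s \<otimes> x) - f x else 0)"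
      unfolding coboundaries_S_def by blast
    show "(\<lambda>i. c * v i) \<in> ?B"
      unfolding coboundaries_S_def using l2_scale[OF f, of c]
      by (intro CollectI bexI[of _ "\<lambda>x. c * f x"]) (simp_all add: v algebra_simps)
  qed
  then have "0 \<le> vN_dim_S G H S (l2_closure (S \<times> H) ?B)"
    unfolding vN_dim_S_def l2_unit_def[symmetric]
    by (intro sum_nonneg l2_proj_unit_diag_bounds(1)) (auto simp: cl)
  then show ?thesis by (simp add: L2_betti1_S_def vN_dim_cocycles)
qed

text \<open>Passes from the generating set chosen by \<open>SOME\<close> to an arbitrary
  \<open>T\<close>, later one of minimal size.\<close>

lemma L2_betti1_le:
  assumes T: "generating_set G H T"
  shows "L2_betti1 G H \<le> (\<Sum>s\<in>T. cocycle_density G H T s)"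
proof -
  let ?S = "SOME S. generating_set G H S"
  have S: "generating_set G H ?S" using T by (rule someI)
  have "L2_betti1 G H \<le> vN_dim_S G H ?S (cocycles_S G H ?S)"
    unfolding L2_betti1_def vN_dim_cocycles by (rule L2_betti1_S_le[OF S])
  then show ?thesis using vN_dim_cocycles_eq[OF S T] by (simp add: vN_dim_cocycles)
qed

section \<open>Edges inside finite sets\<close>

text \<open>The projection is compressed to the edges \<open>E\<close> with both ends in
  \<open>F\<close>. Its rows there are gradients of functions on \<open>F\<close>, so its rank is at
  most \<open>card F\<close>; its trace is the left side.\<close>

lemma sum_density_edges_le:
  assumes S: "generating_set G H S" and F: "finite F" "F \<subseteq> H"
  shows "(\<Sum>s\<in>S. cocycle_density G H S s * card {x \<in> F. inv s \<otimes> x \<in> F}) \<le> card F"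
proof -
  note SD = generating_setD[OF S]
  note H = SD(3)
  note cl = subgroup.m_closed[OF H] subgroup.m_inv_closed[OF H] subgroup.mem_carrier[OF H] subgroup.one_closed[OF H]
  note Z = cocycles_S_closed_subspace[OF S]
  define E where "E = (SIGMA s:S. {x \<in> F. inv s \<otimes> x \<in> F})"
  have fE: "finite E" unfolding E_def using SD F by auto
  have ES: "E \<subseteq> S \<times> H" unfolding E_def using F by auto
  define a where "a e = l2_proj (S \<times> H) (cocycles_S G H S) (l2_unit e)" for e
  have aZ: "a e \<in> cocycles_S G H S" if "e \<in> E" for e
    unfolding a_def by (rule l2_proj_in[OF Z l2_unit]) (use that ES in auto)
  \<comment> \<open>The gradient of the indicator function of \<open>y\<close>. Both ends of an edge
    in \<open>E\<close> lie in \<open>F\<close>, so only the values of \<open>b\<close> on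
    \<open>F\<close> enter.\<close>
  define D where "D y = (\<lambda>(s, x). (if inv s \<otimes> x = y then 1 else 0) - (if x = y then 1 else 0 :: complex))" for y
  have span: "\<exists>b. \<forall>i\<in>E. a e i = (\<Sum>y\<in>F. b y * D y i)" if e: "e \<in> E" for e
  proof -
    obtain b where b: "potential H S b (a e)" using aZ[OF e] by (auto simp: cocycles_S_iff[OF S])
    have "a e (s, x) = (\<Sum>y\<in>F. b y * D y (s, x))" if "(s, x) \<in> E" for s x
    proof -
      have sx: "s \<in> S" "x \<in> F" "inv s \<otimes> x \<in> F" "x \<in> H" using that F by (auto simp: E_def)
      have "(\<Sum>y\<in>F. b y * D y (s, x)) =
        (\<Sum>y\<in>F. if inv s \<otimes> x = y then b y else 0) - (\<Sum>y\<in>F. if x = y then b y else 0)"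
        unfolding D_def by (simp add: right_diff_distrib sum_subtractf if_distrib[of "\<lambda>z. _ * z"] cong: if_cong)
      also have "\<dots> = b (inv s \<otimes> x) - b x" using F sx by (simp add: sum.delta)
      finally show ?thesis using b sx by (simp add: potential_def)
    qed
    then have "\<forall>i\<in>E. a e i = (\<Sum>y\<in>F. b y * D y i)" by auto
    then show ?thesis by blast
  qed
  have "(\<Sum>e\<in>E. Re (a e e)) \<le> card F"
  proof (rule trace_le_rank[OF fE F(1) span])
    fix e assume e: "e \<in> E"
    then have eI: "e \<in> S \<times> H" using ES by auto
    have "(\<Sum>i\<in>E. (cmod (a e i))\<^sup>2) \<le> l2_sq (S \<times> H) (a e)"
      by (rule l2_sq_ge_sum[OF l2_closed_subspace_l2[OF Z aZ[OF e]] fE ES])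
    also have "\<dots> = Re (a e e)" unfolding a_def using l2_proj_unit_diag[OF Z eI] by simp
    finally show "(\<Sum>i\<in>E. (cmod (a e i))\<^sup>2) \<le> Re (a e e)" .
  qed
  \<comment> \<open>Right invariance makes the diagonal entry independent of
    \<open>x\<close>.\<close>
  moreover have "Re (a (s, x) (s, x)) = cocycle_density G H S s" if "s \<in> S" "x \<in> H" for s x
    unfolding a_def l2_proj_cocycles_unit_shift[OF S that(2,1)] cocycle_density_def
    using that by (simp add: rshift_def cl)
  then have "(\<Sum>e\<in>E. Re (a e e)) = (\<Sum>(s, x)\<in>E. cocycle_density G H S s)"
    using ES by (intro sum.cong) auto
  moreover have "(\<Sum>(s, x)\<in>E. cocycle_density G H S s) =
    (\<Sum>s\<in>S. \<Sum>x\<in>{x \<in> F. inv s \<otimes> x \<in> F}. cocycle_density G H S s)"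
    unfolding E_def by (rule sum.Sigma[symmetric]) (use SD F in auto)
  ultimately show ?thesis by (simp add: mult.commute)
qed

text \<open>The injection \<open>?\<phi>\<close> carries the coset into \<open>H\<close> and turns
  right multiplication by \<open>s\<close> into left multiplication by \<open>inv s\<close>, the
  edge convention of \<open>sum_density_edges_le\<close>.\<close>

lemma sum_density_edges_coset_le:
  assumes S: "generating_set G H S" and a: "a \<in> carrier G" and F: "finite F" "F \<subseteq> a <# H"
  shows "(\<Sum>s\<in>S. cocycle_density G H S s * card {g \<in> F. g \<otimes> s \<in> F}) \<le> card F"
proof -
  note SD = generating_setD[OF S]
  note H = SD(3)
  note cl = subgroup.m_closed[OF H] subgroup.m_inv_closed[OF H] subgroup.mem_carrier[OF H] subgroup.one_closed[OF H]
  let ?\<phi> = "\<lambda>g. inv g \<otimes> a"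
  have Fc: "F \<subseteq> carrier G" using F(2) a l_coset_subset_G[OF subgroup.subset[OF H] a] by auto
  have inj: "inj_on ?\<phi> (carrier G)"
  proof (rule inj_onI)
    fix g k assume gk: "g \<in> carrier G" "k \<in> carrier G" "inv g \<otimes> a = inv k \<otimes> a"
    then have "inv g = inv k" using a by simp
    then show "g = k" using gk inv_inv by metis
  qed
  have FH: "?\<phi> ` F \<subseteq> H"
  proof
    fix y assume "y \<in> ?\<phi> ` F"
    then obtain h where h: "h \<in> H" "y = inv (a \<otimes> h) \<otimes> a" using F(2) unfolding l_coset_def by auto
    then have "y = inv h" using a by (simp add: inv_mult_group cl m_assoc)
    then show "y \<in> H" using h cl by simp
  qed
  have eq: "card {x \<in> ?\<phi> ` F. inv s \<otimes> x \<in> ?\<phi> ` F} = card {g \<in> F. g \<otimes> s \<in> F}" if s: "s \<in> S" for s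
  proof -
    have sc: "s \<in> carrier G" using s SD by auto
    have "inv s \<otimes> ?\<phi> g \<in> ?\<phi> ` F \<longleftrightarrow> g \<otimes> s \<in> F" if g: "g \<in> F" for g
    proof -
      have gc: "g \<in> carrier G" using g Fc by auto
      have "inv s \<otimes> ?\<phi> g = ?\<phi> (g \<otimes> s)" using gc sc a by (simp add: inv_mult_group m_assoc)
      then show ?thesis using inj_on_image_mem_iff[OF inj _ Fc, of "g \<otimes> s"] gc sc by simp
    qed
    then have "{x \<in> ?\<phi> ` F. inv s \<otimes> x \<in> ?\<phi> ` F} = ?\<phi> ` {g \<in> F. g \<otimes> s \<in> F}" by blast
    then show ?thesis using card_image[OF inj_on_subset[OF inj], of "{g \<in> F. g \<otimes> s \<in> F}"] Fc by auto
  qed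
  have "card (?\<phi> ` F) = card F" using card_image[OF inj_on_subset[OF inj Fc]] .
  with sum_density_edges_le[OF S finite_imageI[OF F(1)] FH] show ?thesis by (simp add: eq)
qed

text \<open>Right multiplication by elements of \<open>H\<close> preserves left cosets of
  \<open>H\<close>, so no edge joins two of them. The induction splits off one coset at a
  time.\<close>

lemma sum_density_right_edges_le:
  assumes S: "generating_set G H S" and F: "finite F" "F \<subseteq> carrier G"
  shows "(\<Sum>s\<in>S. cocycle_density G H S s * card {g \<in> F. g \<otimes> s \<in> F}) \<le> card F"
  using F
proof (induction F rule: finite_psubset_induct)
  case (psubset F)
  note SD = generating_setD[OF S]
  note H = SD(3)
  show ?case
  proof (cases "F = {}")
    case False
    then obtain a where a: "a \<in> F" by blast
    then have ac: "a \<in> carrier G" using psubset by auto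
    define A where "A = F \<inter> (a <# H)"
    define B where "B = F - (a <# H)"
    have "a \<in> a <# H" using ac subgroup.one_closed[OF H] unfolding l_coset_def by force
    then have B: "B \<subset> F" using a by (auto simp: B_def)
    have fin: "finite A" "finite B" using psubset by (auto simp: A_def B_def)
    have AB: "A \<inter> B = {}" "A \<union> B = F" by (auto simp: A_def B_def)
    have step: "g \<otimes> s \<in> a <# H \<longleftrightarrow> g \<in> a <# H" if "g \<in> F" "s \<in> S" for g s
    proof -
      have s: "s \<in> H" "s \<in> carrier G" and g: "g \<in> carrier G" using that SD psubset by auto
      have right: "x \<otimes> h \<in> a <# H" if x: "x \<in> a <# H" and h: "h \<in> H" for x h
      proof -
        obtain k where k: "k \<in> H" "x = a \<otimes> k" using x unfolding l_coset_def by auto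
        then have "x \<otimes> h = a \<otimes> (k \<otimes> h)" using ac h subgroup.mem_carrier[OF H] by (simp add: m_assoc)
        then show ?thesis unfolding l_coset_def using k h subgroup.m_closed[OF H] by auto
      qed
      have "g \<otimes> s \<otimes> inv s = g" using s g by (simp add: m_assoc)
      then show ?thesis using right[of "g \<otimes> s" "inv s"] right[of g s] s subgroup.m_inv_closed[OF H] by auto
    qed
    have "card {g \<in> F. g \<otimes> s \<in> F} = card {g \<in> A. g \<otimes> s \<in> A} + card {g \<in> B. g \<otimes> s \<in> B}" if s: "s \<in> S" for s
    proof -
      have "{g \<in> F. g \<otimes> s \<in> F} = {g \<in> A. g \<otimes> s \<in> A} \<union> {g \<in> B. g \<otimes> s \<in> B}"
        using step[OF _ s] by (auto simp: A_def B_def)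
      also have "card \<dots> = card {g \<in> A. g \<otimes> s \<in> A} + card {g \<in> B. g \<otimes> s \<in> B}"
        by (rule card_Un_disjoint) (use fin AB in auto)
      finally show ?thesis .
    qed
    then have "(\<Sum>s\<in>S. cocycle_density G H S s * card {g \<in> F. g \<otimes> s \<in> F}) =
      (\<Sum>s\<in>S. cocycle_density G H S s * card {g \<in> A. g \<otimes> s \<in> A}) +
      (\<Sum>s\<in>S. cocycle_density G H S s * card {g \<in> B. g \<otimes> s \<in> B})"
      unfolding sum.distrib[symmetric] by (intro sum.cong) (simp_all add: distrib_left)
    also have "\<dots> \<le> real (card A) + real (card B)"
    proof (rule add_mono)
      show "(\<Sum>s\<in>S. cocycle_density G H S s * card {g \<in> A. g \<otimes> s \<in> A}) \<le> card A"
        by (rule sum_density_edges_coset_le[OF S ac fin(1)]) (simp add: A_def)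
      show "(\<Sum>s\<in>S. cocycle_density G H S s * card {g \<in> B. g \<otimes> s \<in> B}) \<le> card B"
        by (rule psubset.IH[OF B]) (use psubset.prems in \<open>auto simp: B_def\<close>)
    qed
    also have "\<dots> = card F" using card_Un_disjoint[OF fin AB(1)] AB(2) by simp
    finally show ?thesis .
  qed simp
qed

section \<open>Isoperimetry and level sets of the density\<close>

definition inner_edges :: "'a set \<Rightarrow> 'a \<Rightarrow> nat" where
  "inner_edges F s = card {g \<in> F. g \<otimes> s \<in> F}"

lemma inner_edges_le: "finite F \<Longrightarrow> inner_edges F s \<le> card F"
  unfolding inner_edges_def by (rule card_mono) auto

text \<open>Edges are reversed; hence adjoining inverses to a set of labels at most doubles the
  count.\<close>

lemma inner_edges_inv:
  assumes F: "finite F" "F \<subseteq> carrier G" and s: "s \<in> carrier G"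
  shows "inner_edges F (inv s) = inner_edges F s"
proof -
  have "bij_betw (\<lambda>g. g \<otimes> s) {g \<in> F. g \<otimes> s \<in> F} {g \<in> F. g \<otimes> inv s \<in> F}"
    by (rule bij_betwI[of _ _ _ "\<lambda>g. g \<otimes> inv s"]) (use F s in \<open>auto simp: m_assoc subset_iff\<close>)
  then show ?thesis unfolding inner_edges_def by (rule bij_betw_same_card[symmetric])
qed

lemma cay_boundary_inner_edges:
  assumes "finite F" "finite S"
  shows "real (cay_boundary G S F) = real (card S) * real (card F) - (\<Sum>s\<in>S. real (inner_edges F s))"
proof -
  have "{(g, s). g \<in> F \<and> s \<in> S \<and> g \<otimes> s \<notin> F} = prod.swap ` (SIGMA s:S. F - {g \<in> F. g \<otimes> s \<in> F})" by auto
  then have "cay_boundary G S F = card (SIGMA s:S. F - {g \<in> F. g \<otimes> s \<in> F})"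
    unfolding cay_boundary_def by (simp add: card_image)
  also have "\<dots> = (\<Sum>s\<in>S. card (F - {g \<in> F. g \<otimes> s \<in> F}))" by (rule card_SigmaI) (use assms in auto)
  finally have "real (cay_boundary G S F) = (\<Sum>s\<in>S. real (card (F - {g \<in> F. g \<otimes> s \<in> F})))" by simp
  also have "\<dots> = (\<Sum>s\<in>S. real (card F) - real (inner_edges F s))"
  proof (rule sum.cong[OF refl])
    fix s
    have "card (F - {g \<in> F. g \<otimes> s \<in> F}) = card F - card {g \<in> F. g \<otimes> s \<in> F}"
      by (rule card_Diff_subset) (use assms in auto)
    then show "real (card (F - {g \<in> F. g \<otimes> s \<in> F})) = real (card F) - real (inner_edges F s)"
      using inner_edges_le[OF assms(1), of s] unfolding inner_edges_def by (simp add: of_nat_diff)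
  qed
  finally show ?thesis by (simp add: sum_subtractf)
qed

lemma cheeger_ge:
  assumes "\<And>F. finite F \<Longrightarrow> F \<noteq> {} \<Longrightarrow> F \<subseteq> carrier G \<Longrightarrow> b * real (card F) \<le> real (cay_boundary G S F)"
  shows "b \<le> cheeger G S"
  unfolding cheeger_def
proof (rule cInf_greatest)
  have "finite {\<one>}" "{\<one>} \<noteq> {}" "{\<one>} \<subseteq> carrier G" by auto
  then show "{real (cay_boundary G S F) / real (card F) |F. finite F \<and> F \<noteq> {} \<and> F \<subseteq> carrier G} \<noteq> {}" by blast
next
  fix x assume "x \<in> {real (cay_boundary G S F) / real (card F) |F. finite F \<and> F \<noteq> {} \<and> F \<subseteq> carrier G}"
  then obtain F where F: "finite F" "F \<noteq> {}" "F \<subseteq> carrier G" and x: "x = real (cay_boundary G S F) / real (card F)" by blast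
  have "card F > 0" using F by (simp add: card_gt_0_iff)
  then show "b \<le> x" using assms[OF F] unfolding x by (simp add: field_simps)
qed

lemma cheeger_le:
  assumes "finite F" "F \<noteq> {}" "F \<subseteq> carrier G"
  shows "cheeger G S \<le> cay_boundary G S F / card F"
  unfolding cheeger_def
proof (rule cInf_lower)
  show "real (cay_boundary G S F) / real (card F) \<in>
    {real (cay_boundary G S F) / real (card F) |F. finite F \<and> F \<noteq> {} \<and> F \<subseteq> carrier G}"
    using assms by blast
  show "bdd_below {real (cay_boundary G S F) / real (card F) |F. finite F \<and> F \<noteq> {} \<and> F \<subseteq> carrier G}"
    unfolding bdd_below_def by (intro exI[of _ 0]) auto
qed

text \<open>The test set \<open>{\<one>}\<close> contains the loop labelled \<open>\<one>\<close>,
  so the Cheeger constant is strictly less than \<open>card S\<close>.\<close>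

lemma cay_e_bounds:
  assumes S: "finite S" "\<one> \<in> S"
  shows "0 < cay_e G S" "cay_e G S \<le> 1"
proof -
  have c: "real (card S) > 0" using S by (auto simp: card_gt_0_iff)
  have "0 \<le> cheeger G S" by (rule cheeger_ge) simp
  then show "cay_e G S \<le> 1" using c by (simp add: cay_e_def)
  have "cheeger G S \<le> cay_boundary G S {\<one>} / card {\<one>}" by (rule cheeger_le) auto
  also have "\<dots> = real (card S) - (\<Sum>s\<in>S. real (inner_edges {\<one>} s))"
    using cay_boundary_inner_edges[of "{\<one>}" S] S by simp
  also have "(\<Sum>s\<in>S. real (inner_edges {\<one>} s)) \<ge> real (inner_edges {\<one>} \<one>)"
    by (rule member_le_sum) (use S in auto)
  moreover have "inner_edges {\<one>} \<one> = 1"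
  proof -
    have "{g \<in> {\<one>}. g \<otimes> \<one> \<in> {\<one>}} = {\<one>}" by auto
    then show ?thesis unfolding inner_edges_def by simp
  qed
  ultimately have "cheeger G S < real (card S)" by simp
  then show "0 < cay_e G S" using c by (simp add: cay_e_def)
qed

text \<open>Forcing \<open>\<one> \<in> S\<close> keeps \<open>cay_e G S'\<close> positive, away from the junk values of \<open>ln\<close>.\<close>

lemma eta_less_bound:
  assumes inf: "infinite (carrier G)" and \<epsilon>: "eta G < ereal \<epsilon>"
  obtains S where "sym_fin G S" "\<one> \<in> S"
    and "\<And>S'. sym_fin G S' \<Longrightarrow> S \<subseteq> S' \<Longrightarrow> real (card S') powr (1 - \<epsilon>) \<le> real (card S') * cay_e G S'"
    and "\<epsilon> > 0"
proof -
  let ?r = "\<lambda>S'. ln (cay_e G S') / ln (real (card S'))"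
  \<comment> \<open>A number below the supremum is below the infimum for some \<open>S0\<close>,
    hence below the quotient for every larger \<open>S'\<close>.\<close>
  have "- ereal \<epsilon> < (SUP S\<in>{S. sym_fin G S}. INF S'\<in>{S'. sym_fin G S' \<and> S \<subseteq> S'}. ereal (?r S'))"
    using \<epsilon> inf unfolding eta_def by (simp add: ereal_uminus_less_reorder)
  then obtain S0 where S0: "sym_fin G S0"
    and l: "- ereal \<epsilon> < (INF S'\<in>{S'. sym_fin G S' \<and> S0 \<subseteq> S'}. ereal (?r S'))"
    unfolding less_SUP_iff by auto
  have rr: "- \<epsilon> < ?r S'" if "sym_fin G S'" "S0 \<subseteq> S'" for S'
  proof -
    have "- ereal \<epsilon> < ereal (?r S')"
      by (rule less_le_trans[OF l]) (rule INF_lower, use that in auto)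
    then show ?thesis by simp
  qed
  define S where "S = insert \<one> S0"
  have S: "sym_fin G S" using S0 by (auto simp: sym_fin_def S_def)
  have le: "real (card S') powr (1 - \<epsilon>) \<le> real (card S') * cay_e G S'"
    if S': "sym_fin G S'" "S \<subseteq> S'" for S'
  proof -
    have fin: "finite S'" "\<one> \<in> S'" using S' by (auto simp: sym_fin_def S_def)
    note e = cay_e_bounds[OF fin]
    have c: "card S' \<ge> 1" using fin by (metis One_nat_def Suc_leI card_gt_0_iff empty_iff)
    show ?thesis
    proof (cases "card S' = 1")
      \<comment> \<open>Here the quotient divides by \<open>ln 1 = 0\<close> and says nothing about
        \<open>cay_e\<close>. But \<open>S' = {\<one>}\<close> and \<open>{\<one>}\<close> has no
        boundary, so \<open>cay_e\<close> is at least 1.\<close>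
      case True
      then have "S' = {\<one>}" using fin by (metis card_1_singletonE singletonD)
      then have empty: "{(g, s). g \<in> {\<one>} \<and> s \<in> S' \<and> g \<otimes> s \<notin> {\<one>}} = {}" by auto
      have "cheeger G S' \<le> cay_boundary G S' {\<one>} / card {\<one>}" by (rule cheeger_le) auto
      also have "\<dots> = 0" unfolding cay_boundary_def empty by simp
      finally show ?thesis using True by (simp add: cay_e_def)
    next
      case False
      then have c2: "real (card S') > 1" using c by linarith
      have "- \<epsilon> < ?r S'" by (rule rr) (use S' in \<open>auto simp: S_def\<close>)
      then have "- \<epsilon> * ln (real (card S')) < ln (cay_e G S')" using c2 by (simp add: field_simps)
      then have "exp (- \<epsilon> * ln (real (card S'))) \<le> cay_e G S'"
        using e by (metis exp_less_cancel_iff exp_ln less_imp_le)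
      then have "real (card S') powr (- \<epsilon>) \<le> cay_e G S'" using c2 by (simp add: powr_def)
      then have "real (card S') * real (card S') powr (- \<epsilon>) \<le> real (card S') * cay_e G S'"
        by (rule mult_left_mono) simp
      moreover have "real (card S') * real (card S') powr (- \<epsilon>) = real (card S') powr (1 - \<epsilon>)"
        using c2 powr_add[of "real (card S')" 1 "-\<epsilon>"] by simp
      ultimately show ?thesis by simp
    qed
  qed
  \<comment> \<open>As \<open>cay_e\<close> is at most 1, the quotient is nonpositive; for a
    singleton \<open>S\<close> it is 0 by the convention on division by zero.\<close>
  have "\<epsilon> > 0"
  proof -
    have fin: "finite S" "\<one> \<in> S" using S by (auto simp: sym_fin_def S_def)
    have "card S \<ge> 1" using fin by (metis One_nat_def Suc_leI card_gt_0_iff empty_iff)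
    then have "?r S \<le> 0" using cay_e_bounds[OF fin] by (simp add: divide_nonpos_nonneg)
    moreover have "- \<epsilon> < ?r S" by (rule rr[OF S]) (auto simp: S_def)
    ultimately show ?thesis by linarith
  qed
  with S le show ?thesis using that[of S] by (simp add: S_def)
qed

end

text \<open>A minimizer \<open>m\<close> is removed. All of \<open>T\<close> is a level set for
  \<open>t = f m\<close>, so \<open>f m\<close> is at most
  \<open>K * card T powr (\<epsilon> - 1)\<close>, and these bounds add up as in the integral of
  that power.\<close>

lemma sum_le_if_level_sets_small:
  fixes f :: "'a \<Rightarrow> real" and \<epsilon> :: real
  assumes \<epsilon>: "0 < \<epsilon>" "\<epsilon> < 1" and K: "0 \<le> K" and T: "finite T"
    and level: "\<And>A t. A \<subseteq> T \<Longrightarrow> A \<noteq> {} \<Longrightarrow> 0 < t \<Longrightarrow> (\<And>s. s \<in> A \<Longrightarrow> t \<le> f s) \<Longrightarrow>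
      real (card A) powr (1 - \<epsilon>) \<le> K / t"
  shows "(\<Sum>s\<in>T. f s) \<le> K / \<epsilon> * real (card T) powr \<epsilon>"
  using T level
proof (induction "card T" arbitrary: T)
  case 0
  then show ?case by simp
next
  case (Suc n)
  then have ne: "T \<noteq> {}" by auto
  obtain m where m: "m \<in> T" "\<And>s. s \<in> T \<Longrightarrow> f m \<le> f s"
    using ne Suc.prems(1) by (metis (mono_tags, lifting) arg_min_if_finite(1) arg_min_least)
  have cT: "card (T - {m}) = n" using Suc m by simp
  have IH: "(\<Sum>s\<in>T - {m}. f s) \<le> K / \<epsilon> * real n powr \<epsilon>"
    using Suc.hyps(1)[of "T - {m}"] Suc.prems cT by blast
  let ?N = "real (Suc n)"
  have fm: "f m \<le> K * ?N powr (\<epsilon> - 1)"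
  proof (cases "f m > 0")
    case True
    have "?N powr (1 - \<epsilon>) \<le> K / f m"
      using Suc.prems(2)[OF order_refl ne True] m Suc.hyps(2) by simp
    then have "f m * ?N powr (1 - \<epsilon>) \<le> K" using True by (simp add: field_simps)
    then have "f m \<le> K / ?N powr (1 - \<epsilon>)" by (simp add: field_simps)
    also have "\<dots> = K * ?N powr (\<epsilon> - 1)" using powr_minus_divide[of ?N "1 - \<epsilon>"] by simp
    finally show ?thesis .
  next
    case False
    moreover have "0 \<le> K * ?N powr (\<epsilon> - 1)" using K by simp
    ultimately show ?thesis by linarith
  qed
  \<comment> \<open>The power with exponent \<open>\<epsilon> - 1\<close> decreases, so its value at
    the intermediate point is at least that at \<open>?N\<close>. For \<open>n = 0\<close> the mean
    value theorem is avoided, and \<open>0 powr \<epsilon> = 0\<close>.\<close>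
  have mvt: "real n powr \<epsilon> + \<epsilon> * ?N powr (\<epsilon> - 1) \<le> ?N powr \<epsilon>"
  proof (cases "n = 0")
    case True
    then show ?thesis using \<epsilon> by simp
  next
    case False
    have "\<exists>z. real n < z \<and> z < ?N \<and> ?N powr \<epsilon> - real n powr \<epsilon> = (?N - real n) * (\<epsilon> * z powr (\<epsilon> - 1))"
      by (rule MVT2) (use False in \<open>auto intro!: derivative_eq_intros\<close>)
    then obtain z where z: "real n < z" "z < ?N" "?N powr \<epsilon> - real n powr \<epsilon> = \<epsilon> * z powr (\<epsilon> - 1)" by auto
    have "?N powr (\<epsilon> - 1) \<le> z powr (\<epsilon> - 1)" by (rule powr_mono2') (use z False \<epsilon> in auto)
    then have "\<epsilon> * ?N powr (\<epsilon> - 1) \<le> \<epsilon> * z powr (\<epsilon> - 1)" using \<epsilon> by simp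
    with z show ?thesis by linarith
  qed
  have "(\<Sum>s\<in>T. f s) = f m + (\<Sum>s\<in>T - {m}. f s)" using Suc.prems(1) m by (simp add: sum.remove)
  also have "\<dots> \<le> K * ?N powr (\<epsilon> - 1) + K / \<epsilon> * real n powr \<epsilon>" using fm IH by linarith
  also have "\<dots> = K / \<epsilon> * (real n powr \<epsilon> + \<epsilon> * ?N powr (\<epsilon> - 1))" using \<epsilon> by (simp add: field_simps)
  also have "\<dots> \<le> K / \<epsilon> * ?N powr \<epsilon>" by (rule mult_left_mono[OF mvt]) (use K \<epsilon> in auto)
  finally show ?case using Suc.hyps(2) by simp
qed

context group
begin

text \<open>Inside a finite \<open>F\<close>, each label in \<open>S\<close> has at most
  \<open>card F\<close> edges, while by the density bound all labels in \<open>A\<close> together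
  have at most \<open>card F / t\<close>, and so have their inverses. Few inner edges force a large
  Cheeger constant of \<open>S'\<close>, which \<open>eta\<close> permits only if \<open>A\<close>
  is small.\<close>

lemma density_level_set:
  assumes T: "generating_set G H T" and S: "sym_fin G S" "\<one> \<in> S"
    and eta: "\<And>S'. sym_fin G S' \<Longrightarrow> S \<subseteq> S' \<Longrightarrow> real (card S') powr (1 - \<epsilon>) \<le> real (card S') * cay_e G S'"
    and \<epsilon>: "\<epsilon> < 1" and A: "A \<subseteq> T" "A \<noteq> {}" and t: "0 < t" "\<And>s. s \<in> A \<Longrightarrow> t \<le> cocycle_density G H T s"
  shows "real (card A) powr (1 - \<epsilon>) \<le> (real (card S) + 2) / t"
proof -
  note TD = generating_setD[OF T]
  let ?f = "cocycle_density G H T"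
  let ?A' = "(\<lambda>s. inv s) ` A"
  define S' where "S' = S \<union> (A \<union> ?A')"
  have Ac: "A \<subseteq> carrier G" "finite A" using A TD finite_subset[OF A(1)] by auto
  have fS: "finite S" "S \<subseteq> carrier G" using S by (auto simp: sym_fin_def)
  have S': "sym_fin G S'" "S \<subseteq> S'" using S Ac by (auto simp: sym_fin_def S'_def)
  have fS': "finite S'" using S' by (auto simp: sym_fin_def)
  have c: "real (card S') > 0" using fS' S S' by (auto simp: card_gt_0_iff)
  \<comment> \<open>Used at the end to absorb \<open>card S\<close> into
    \<open>card S / t\<close>.\<close>
  have t1: "t \<le> 1"
  proof -
    obtain s where s: "s \<in> A" using A by blast
    then have "s \<in> T" using A by auto
    then show ?thesis using t(2)[OF s] cocycle_density_bounds(2)[OF T] by fastforce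
  qed
  have "real (card S') - (real (card S) + 2 / t) \<le> cheeger G S'"
  proof (rule cheeger_ge)
    fix F assume F: "finite F" "F \<noteq> {}" "F \<subseteq> carrier G"
    let ?n = "\<lambda>s. real (inner_edges F s)"
    have "t * (\<Sum>s\<in>A. ?n s) = (\<Sum>s\<in>A. t * ?n s)" by (rule sum_distrib_left)
    also have "\<dots> \<le> (\<Sum>s\<in>A. ?f s * ?n s)" by (intro sum_mono mult_right_mono t) auto
    also have "\<dots> \<le> (\<Sum>s\<in>T. ?f s * ?n s)"
      by (rule sum_mono2) (use TD A cocycle_density_bounds(1)[OF T] in auto)
    also have "\<dots> \<le> card F"
      using sum_density_right_edges_le[OF T F(1,3)] by (simp add: inner_edges_def)
    finally have a1: "(\<Sum>s\<in>A. ?n s) \<le> card F / t" using t by (simp add: field_simps)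
    have "(\<Sum>s\<in>?A'. ?n s) = (\<Sum>s\<in>A. ?n (inv s))"
      by (rule sum.reindex_cong[OF _ refl refl]) (use Ac in \<open>metis inj_onI inv_inj subsetD inj_on_subset\<close>)
    also have "\<dots> = (\<Sum>s\<in>A. ?n s)"
      by (rule sum.cong) (use Ac inner_edges_inv[OF F(1,3)] in auto)
    finally have a2: "(\<Sum>s\<in>?A'. ?n s) \<le> card F / t" using a1 by simp
    have "(\<Sum>s\<in>S'. ?n s) \<le> (\<Sum>s\<in>S. ?n s) + ((\<Sum>s\<in>A. ?n s) + (\<Sum>s\<in>?A'. ?n s))"
    proof -
      \<comment> \<open>The sets \<open>S\<close>, \<open>A\<close> and \<open>?A'\<close> may
        overlap, so only subadditivity is available.\<close>
      have le: "(\<Sum>s\<in>X \<union> Y. ?n s) \<le> (\<Sum>s\<in>X. ?n s) + (\<Sum>s\<in>Y. ?n s)" if "finite X" "finite Y" for X Y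
        using sum.union_inter[OF that, of ?n] sum_nonneg[of "X \<inter> Y" ?n] by simp
      show ?thesis unfolding S'_def
        using le[OF fS(1), of "A \<union> ?A'"] le[OF Ac(2), of ?A'] Ac by simp
    qed
    also have "(\<Sum>s\<in>S. ?n s) \<le> (\<Sum>s\<in>S. real (card F))"
      by (rule sum_mono) (simp add: inner_edges_le[OF F(1)])
    finally have "(\<Sum>s\<in>S'. ?n s) \<le> real (card S) * card F + (card F / t + card F / t)" using a1 a2 by simp
    also have "\<dots> = (real (card S) + 2 / t) * card F" by (simp add: algebra_simps)
    finally have "(\<Sum>s\<in>S'. ?n s) \<le> (real (card S) + 2 / t) * card F" .
    then show "(real (card S') - (real (card S) + 2 / t)) * card F \<le> cay_boundary G S' F"
      using cay_boundary_inner_edges[OF F(1) fS'] by (simp add: algebra_simps)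
  qed
  moreover have "real (card S') * cay_e G S' = real (card S') - cheeger G S'"
    using c by (simp add: cay_e_def right_diff_distrib)
  ultimately have "real (card S') * cay_e G S' \<le> real (card S) + 2 / t" by linarith
  moreover have "real (card A) powr (1 - \<epsilon>) \<le> real (card S') powr (1 - \<epsilon>)"
    by (rule powr_mono2) (use \<epsilon> fS' in \<open>auto intro!: card_mono simp: S'_def\<close>)
  moreover have "real (card S) + 2 / t \<le> (real (card S) + 2) / t"
  proof -
    have "real (card S) * t \<le> real (card S)" using t1 by (simp add: mult_left_le)
    then show ?thesis using t(1) by (simp add: field_simps)
  qed
  ultimately show ?thesis using eta[OF S'] by linarith
qed

lemma L2_betti1_le_rank_powr:
  assumes inf: "infinite (carrier G)" and \<epsilon>: "eta G < ereal \<epsilon>"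
  shows "\<exists>C. \<forall>H. fg_subgroup G H \<longrightarrow> L2_betti1 G H / real (rank G H) powr \<epsilon> \<le> C"
proof -
  obtain S where S: "sym_fin G S" "\<one> \<in> S"
    and eta: "\<And>S'. sym_fin G S' \<Longrightarrow> S \<subseteq> S' \<Longrightarrow> real (card S') powr (1 - \<epsilon>) \<le> real (card S') * cay_e G S'"
    and pos: "\<epsilon> > 0"
    using eta_less_bound[OF inf \<epsilon>] by metis
  define K where "K = real (card S) + 2"
  \<comment> \<open>For \<open>\<epsilon> < 1\<close> the level sets give
    \<open>K / \<epsilon>\<close>; for larger \<open>\<epsilon>\<close> densities are at most 1, so
    the sum is at most \<open>card T\<close> and the constant 1 suffices.\<close>
  define C where "C = max 1 (K / \<epsilon>)"
  have "L2_betti1 G H / real (rank G H) powr \<epsilon> \<le> C" if H: "fg_subgroup G H" for H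
  proof -
    have "\<exists>n S. generating_set G H S \<and> card S = n" using H by (auto simp: fg_subgroup_def)
    from LeastI_ex[OF this] obtain T where T: "generating_set G H T" and r: "card T = rank G H"
      unfolding rank_def by auto
    let ?f = "cocycle_density G H T"
    have "(\<Sum>s\<in>T. ?f s) \<le> C * real (card T) powr \<epsilon>"
    proof (cases "\<epsilon> < 1")
      case True
      have "(\<Sum>s\<in>T. ?f s) \<le> K / \<epsilon> * real (card T) powr \<epsilon>"
      proof (rule sum_le_if_level_sets_small[OF pos True])
        fix A t assume A: "A \<subseteq> T" "A \<noteq> {}" "0 < t" "\<And>s. s \<in> A \<Longrightarrow> t \<le> ?f s"
        show "real (card A) powr (1 - \<epsilon>) \<le> K / t"
          unfolding K_def by (rule density_level_set[OF T S eta True A])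
      qed (use generating_setD[OF T] in \<open>auto simp: K_def\<close>)
      also have "\<dots> \<le> C * real (card T) powr \<epsilon>" by (rule mult_right_mono) (auto simp: C_def)
      finally show ?thesis .
    next
      case False
      have "(\<Sum>s\<in>T. ?f s) \<le> (\<Sum>s\<in>T. 1)" by (rule sum_mono) (rule cocycle_density_bounds(2)[OF T])
      also have "\<dots> \<le> real (card T) powr \<epsilon>"
      proof (cases "card T = 0")
        case False
        then have "real (card T) powr 1 \<le> real (card T) powr \<epsilon>" using \<open>\<not> \<epsilon> < 1\<close> by (intro powr_mono) auto
        then show ?thesis by simp
      qed simp
      also have "\<dots> \<le> C * real (card T) powr \<epsilon>" by (simp add: C_def mult_le_cancel_right1)
      finally show ?thesis .
    qed
    with L2_betti1_le[OF T] have "L2_betti1 G H \<le> C * real (rank G H) powr \<epsilon>" by (simp add: r)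
    \<comment> \<open>For rank 0 the denominator is \<open>0 powr \<epsilon> = 0\<close>, so the
      quotient is 0 by convention.\<close>
    then show ?thesis by (cases "rank G H = 0") (auto simp: C_def field_simps)
  qed
  then show ?thesis by blast
qed

end

theorem theorem6p2:
  fixes G :: "('g, 'b) monoid_scheme" and \<epsilon> :: real
  assumes "group G"
    and "ereal \<epsilon> > eta G"
  shows "(SUP H\<in>{H. fg_subgroup G H}. ereal (L2_betti1 G H / real (rank G H) powr \<epsilon>)) < \<infinity>"
proof -
  have "\<exists>C. \<forall>H. fg_subgroup G H \<longrightarrow> L2_betti1 G H / real (rank G H) powr \<epsilon> \<le> C"
  proof (cases "finite (carrier G)")
    \<comment> \<open>Here \<open>eta G\<close> is minus infinity and \<open>\<epsilon>\<close> may
      be any real number, but there are only finitely many subgroups.\<close>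
    case True
    let ?Q = "{H. fg_subgroup G H}" and ?v = "\<lambda>H. L2_betti1 G H / real (rank G H) powr \<epsilon>"
    have "?Q \<subseteq> Pow (carrier G)" by (auto simp: fg_subgroup_def dest: subgroup.mem_carrier)
    then have "finite (?v ` ?Q)" using True by (meson finite_Pow_iff finite_imageI finite_subset)
    then have "bdd_above (?v ` ?Q)" by simp
    then show ?thesis unfolding bdd_above_def by auto
  next
    case False
    then show ?thesis using group.L2_betti1_le_rank_powr[OF assms(1)] assms(2) by blast
  qed
  then obtain C where "\<And>H. fg_subgroup G H \<Longrightarrow> L2_betti1 G H / real (rank G H) powr \<epsilon> \<le> C" by blast
  then have "(SUP H\<in>{H. fg_subgroup G H}. ereal (L2_betti1 G H / real (rank G H) powr \<epsilon>)) \<le> ereal C"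
    by (intro SUP_least) auto
  then show ?thesis by (rule le_less_trans) simp
qed

end
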